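(* Let $r\geq 2$, let $F_r$ be a free group of rank $r$, let $w\in F_r$ be a test element for monomorphisms (for instance, any test element), and let $\mathcal{S}$ be a basis of $F_r$ which minimizes $|w|_{\mathcal{S}}$. For any nontrivial $a\in F_r$, if $|X_a\cap X_w|\geq |w|_{\mathcal{S}}+1$, then $a$ is again a test element for monomorphisms.
   Context: An element $g$ of a group $G$ is a test element if every endomorphism $\phi$ of $G$ with $\phi(g)=g$ is an automorphism of $G$; it is a test element for monomorphisms if every injective endomorphism $\phi$ of $G$ with $\phi(g)=g$ is an automorphism of $G$ (so every test element is a test element for monomorphisms). A basis of $F_r$ means a free generating set. For a basis $\mathcal{S}$ and $u\in F_r$, $|u|_{\mathcal{S}}$ is the length of the unique reduced word in the letters $\mathcal{S}\cup\mathcal{S}^{-1}$ representing $u$. The basis $\mathcal{S}$ minimizes $|u|_{\mathcal{S}}$ if $|u|_{\mathcal{S}}\leq |u|_{\mathcal{S}'}$ for every basis $\mathcal{S}'$ of $F_r$. $F_r$ acts by left multiplication on its Cayley graph $\mathrm{Cay}(F_r,\mathcal{S})$, the tree with vertex set $F_r$ and an edge of length 1 joining $g$ and $gs$ for each $g\in F_r$, $s\in\mathcal{S}$. For a nontrivial $a\in F_r$, the axis $X_a$ is the unique bi-infinite geodesic line in $\mathrm{Cay}(F_r,\mathcal{S})$ that is invariant under $a$ (on which $a$ acts as a nontrivial translation). The intersection $X_a\cap X_w$ of two axes is connected (possibly empty), and $|X_a\cap X_w|\in\{0,1,2,\dots\}\cup\{\infty\}$ denotes its length, i.e. its number of edges.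 A test element for monomorphisms of $F_r$, $r\ge 2$, is automatically nontrivial, so $X_w$ is defined. *)

theory Defs
  imports "HOL-Algebra.Group" "HOL-Library.Extended_Nat"
begin

text \<open>
  A word over \<open>S\<close> is a list of formal letters \<open>(s, b)\<close>, where \<open>(s, True)\<close> stands for
  the letter \<open>s\<close> and \<open>(s, False)\<close> for its formal inverse.
\<close>

definition reduced_words :: "'a set \<Rightarrow> ('a \<times> bool) list set" where
  "reduced_words S =
     {ws \<in> lists (S \<times> UNIV). successively (\<lambda>(s, b) (t, c). s = t \<longrightarrow> b = c) ws}"

definition eval_word :: "('a, 'b) monoid_scheme \<Rightarrow> ('a \<times> bool) list \<Rightarrow> 'a" where
  "eval_word G ws =
     foldr (\<lambda>(s, b) x. (if b then s else inv\<^bsub>G\<^esub> s) \<otimes>\<^bsub>G\<^esub> x) ws \<one>\<^bsub>G\<^esub>"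

definition free_basis :: "('a, 'b) monoid_scheme \<Rightarrow> 'a set \<Rightarrow> bool" where
  "free_basis G S \<longleftrightarrow>
     S \<subseteq> carrier G \<and> (\<forall>g \<in> carrier G. \<exists>!ws. ws \<in> reduced_words S \<and> eval_word G ws = g)"

definition free_group_of_rank :: "('a, 'b) monoid_scheme \<Rightarrow> nat \<Rightarrow> bool" where
  "free_group_of_rank G r \<longleftrightarrow> group G \<and> (\<exists>B. free_basis G B \<and> finite B \<and> card B = r)"

definition word_length :: "('a, 'b) monoid_scheme \<Rightarrow> 'a set \<Rightarrow> 'a \<Rightarrow> nat" where
  "word_length G S u = length (THE ws. ws \<in> reduced_words S \<and> eval_word G ws = u)"

definition minimizing_basis :: "('a, 'b) monoid_scheme \<Rightarrow> 'a set \<Rightarrow> 'a \<Rightarrow> bool" where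
  "minimizing_basis G S u \<longleftrightarrow>
     free_basis G S \<and> (\<forall>S'. free_basis G S' \<longrightarrow> word_length G S u \<le> word_length G S' u)"

definition test_element_mono :: "('a, 'b) monoid_scheme \<Rightarrow> 'a \<Rightarrow> bool" where
  "test_element_mono G g \<longleftrightarrow>
     g \<in> carrier G \<and> (\<forall>\<phi> \<in> mon G G. \<phi> g = g \<longrightarrow> \<phi> \<in> iso G G)"

text \<open>
  For a free basis \<open>S\<close> the Cayley graph has neither loops nor multiple edges, so an edge is
  identified with the set of its two endpoints.
\<close>

definition cayley_edges :: "('a, 'b) monoid_scheme \<Rightarrow> 'a set \<Rightarrow> 'a set set" where
  "cayley_edges G S = {{g, g \<otimes>\<^bsub>G\<^esub> s} |g s. g \<in> carrier G \<and> s \<in> S}"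

definition cayley_dist :: "('a, 'b) monoid_scheme \<Rightarrow> 'a set \<Rightarrow> 'a \<Rightarrow> 'a \<Rightarrow> nat" where
  "cayley_dist G S g h = (LEAST n. (g, h) \<in> {(x, y). {x, y} \<in> cayley_edges G S} ^^ n)"

text \<open>
  A bi-infinite geodesic line is represented by its set of edges, which determines it as a
  subgraph; its vertices are the endpoints of these edges.
\<close>

definition geodesic_line :: "('a, 'b) monoid_scheme \<Rightarrow> 'a set \<Rightarrow> 'a set set \<Rightarrow> bool" where
  "geodesic_line G S L \<longleftrightarrow>
     (\<exists>p :: int \<Rightarrow> 'a.
        range p \<subseteq> carrier G \<and>
        (\<forall>i. {p i, p (i + 1)} \<in> cayley_edges G S) \<and>
        (\<forall>i j. cayley_dist G S (p i) (p j) = nat \<bar>i - j\<bar>) \<and>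
        L = range (\<lambda>i. {p i, p (i + 1)}))"

definition translate_edges :: "('a, 'b) monoid_scheme \<Rightarrow> 'a \<Rightarrow> 'a set set \<Rightarrow> 'a set set" where
  "translate_edges G a L = (\<lambda>e. (\<lambda>x. a \<otimes>\<^bsub>G\<^esub> x) ` e) ` L"

definition axis :: "('a, 'b) monoid_scheme \<Rightarrow> 'a set \<Rightarrow> 'a \<Rightarrow> 'a set set" where
  "axis G S a = (THE L. geodesic_line G S L \<and> translate_edges G a L = L)"

definition num_edges :: "'a set set \<Rightarrow> enat" where
  "num_edges E = (if finite E then enat (card E) else \<infinity>)"

end

theory Submission
  imports Defs "HOL-Algebra.Generated_Groups"
begin

text \<open>
  Let \<open>\<phi>\<close> be an injective endomorphism with \<open>\<phi> a = a\<close> that is not surjective. The images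
  \<open>\<phi>\<^sup>n(F)\<close> all contain \<open>a\<close> and are pairwise distinct. Hence for some \<open>n\<close> a vertex in the hull of
  \<open>\<phi>\<^sup>n(F)\<close> lies on no \<open>\<phi>\<^sup>n(F)\<close>-translate of the segment from 1 to \<open>a\<close>; otherwise every
  \<open>\<phi>\<^sup>n(F)\<close> would be generated by its elements of length at most \<open>2|a| + 1\<close>, which leaves only
  finitely many images. The two sides of an edge of the hull at this vertex pull back along
  \<open>\<phi>\<^sup>n\<close> to a nontrivial almost invariant set \<open>P\<close> with \<open>P a = P\<close>. At a vertex that is
  extremal for the partition of the ends of the tree defined by \<open>P\<close>, the directions (all but one)
  fall into two classes which no translate of \<open>X\<^sub>a\<close> connects.

  The overlap hypothesis says that every turn of \<open>X\<^sub>w\<close> is, up to translation, a turn of \<open>X\<^sub>a\<close>, so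
  the Whitehead graph of \<open>w\<close> would have a cut vertex. This is impossible: \<open>w\<close> involves every
  generator (otherwise squaring a missing generator gives a non-surjective monomorphism fixing \<open>w\<close>),
  and then a Whitehead automorphism at the cut vertex would shorten \<open>w\<close>.
\<close>

subsection \<open>Reduced words and free bases\<close>

text \<open>Pulling back along \<open>\<phi>^n\<close> moves the partition from the image subgroup,
  whose hull is unrelated to \<open>S\<close>, to \<open>F\<close> itself, where the Cayley tree
  with respect to \<open>S\<close> and the axis of \<open>w\<close> live. Injectivity is used twice:
  it keeps the boundary of the pulled-back half-tree finite, and it cancels an equality
  \<open>\<phi>^n(F) = \<phi>^m(F)\<close> down to surjectivity of \<open>\<phi>\<close>. The
  pullback is no longer a half-tree but only has finite boundary, so its behaviour is read off from
  infinite pieces below a vertex, and a vertex farthest from 1 at which both colours persist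
  replaces the endpoint of an edge.

  Minimality of \<open>S\<close> also enters twice. Against conjugations it makes \<open>w\<close>
  cyclically reduced, so that 1 lies on the axis of \<open>w\<close> and the translation length is
  the word length; against Whitehead automorphisms it excludes a cut vertex. The bound
  \<open>|w| + 1\<close> is the number of edges of a segment with \<open>|w|\<close> interior
  vertices, one for each turn of the cyclic word, including the turn that closes it up.

  A cut vertex is never treated through connected components: it is a letter \<open>x\<close>
  together with a partition \<open>A\<close>, \<open>B\<close> of the other letters that no turn
  joins.\<close>

definition flip :: "'a \<times> bool \<Rightarrow> 'a \<times> bool" where
  "flip l = (fst l, \<not> snd l)"

lemma flip_flip [simp]: "flip (flip l) = l"
  and flip_neq [simp]: "flip l \<noteq> l" "l \<noteq> flip l"
  and fst_flip [simp]: "fst (flip l) = fst l"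
  and flip_mem_iff [simp]: "flip l \<in> S \<times> UNIV \<longleftrightarrow> l \<in> S \<times> UNIV"
  by (auto simp: flip_def prod_eq_iff mem_Times_iff)

lemma flip_image_subset_iff [simp]: "flip ` A \<subseteq> S \<times> UNIV \<longleftrightarrow> A \<subseteq> S \<times> UNIV"
  by (simp add: subset_iff image_iff Bex_def) (metis flip_mem_iff mem_Sigma_iff UNIV_I surj_pair)

lemma flip_eq_iff: "flip l = m \<longleftrightarrow> l = flip m"
  by auto

lemma fst_eq_iff_flip: "fst l = fst m \<longleftrightarrow> l = m \<or> l = flip m"
  by (auto simp: flip_def prod_eq_iff)

definition relabel :: "('a \<Rightarrow> 'b) \<Rightarrow> 'a \<times> bool \<Rightarrow> 'b \<times> bool" where
  "relabel f l = (f (fst l), snd l)"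

lemma reduced_words_iff:
  "ws \<in> reduced_words S \<longleftrightarrow> set ws \<subseteq> S \<times> UNIV \<and> successively (\<lambda>l m. m \<noteq> flip l) ws"
proof -
  have "(\<lambda>(s, b) (t, c). s = t \<longrightarrow> b = c) = (\<lambda>l m :: 'a \<times> bool. m \<noteq> flip l)"
    by (auto simp: fun_eq_iff flip_def)
  then show ?thesis
    by (auto simp: reduced_words_def lists_eq_set)
qed

lemma reduced_words_Nil [simp]: "[] \<in> reduced_words S"
  by (simp add: reduced_words_iff)

lemma reduced_words_Cons:
  "l # ws \<in> reduced_words S \<longleftrightarrow>
     l \<in> S \<times> UNIV \<and> ws \<in> reduced_words S \<and> (ws \<noteq> [] \<longrightarrow> hd ws \<noteq> flip l)"
  by (auto simp: reduced_words_iff successively_Cons)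

lemma reduced_words_append:
  "us @ vs \<in> reduced_words S \<longleftrightarrow>
     us \<in> reduced_words S \<and> vs \<in> reduced_words S \<and>
     (us \<noteq> [] \<longrightarrow> vs \<noteq> [] \<longrightarrow> hd vs \<noteq> flip (last us))"
  by (auto simp: reduced_words_iff successively_append_iff)

lemma reduced_words_rev_flip:
  "ws \<in> reduced_words S \<Longrightarrow> rev (map flip ws) \<in> reduced_words S"
  by (auto simp: reduced_words_iff successively_map flip_eq_iff simp del: mem_Sigma_iff
      elim!: successively_mono)

lemma reduced_words_take: "ws \<in> reduced_words S \<Longrightarrow> take k ws \<in> reduced_words S"
  by (metis append_take_drop_id reduced_words_append)

lemma reduced_words_drop: "ws \<in> reduced_words S \<Longrightarrow> drop k ws \<in> reduced_words S"
  by (metis append_take_drop_id reduced_words_append)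

locale based_free_group = group F for F (structure) +
  fixes S :: "'a set"
  assumes basis: "free_basis F S"
begin

definition ev :: "'a \<times> bool \<Rightarrow> 'a" where
  "ev l = (if snd l then fst l else inv (fst l))"

definition nf :: "'a \<Rightarrow> ('a \<times> bool) list" where
  "nf g = (THE ws. ws \<in> reduced_words S \<and> eval_word F ws = g)"

abbreviation len :: "'a \<Rightarrow> nat" where
  "len \<equiv> word_length F S"

abbreviation eval :: "('a \<times> bool) list \<Rightarrow> 'a" where
  "eval \<equiv> eval_word F"

lemma S_closed: "S \<subseteq> carrier F"
  using basis by (simp add: free_basis_def)

lemma len_nf: "len g = length (nf g)"
  by (simp add: word_length_def nf_def)

lemma ev_closed [simp]: "l \<in> S \<times> UNIV \<Longrightarrow> ev l \<in> carrier F"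
  using S_closed by (auto simp: ev_def relabel_def)

lemma ev_flip: "l \<in> S \<times> UNIV \<Longrightarrow> ev (flip l) = inv (ev l)"
  using S_closed by (auto simp: ev_def flip_def)

lemma eval_Nil [simp]: "eval [] = \<one>"
  by (simp add: eval_word_def)

lemma eval_Cons [simp]: "eval (l # ws) = ev l \<otimes> eval ws"
  by (simp add: eval_word_def ev_def case_prod_unfold)

lemma eval_closed [simp]: "set ws \<subseteq> S \<times> UNIV \<Longrightarrow> eval ws \<in> carrier F"
  by (induction ws) auto

lemma eval_append:
  "set us \<subseteq> S \<times> UNIV \<Longrightarrow> set vs \<subseteq> S \<times> UNIV \<Longrightarrow> eval (us @ vs) = eval us \<otimes> eval vs"
  by (induction us) (auto simp: m_assoc)

lemma eval_rev_flip:
  "set ws \<subseteq> S \<times> UNIV \<Longrightarrow> eval (rev (map flip ws)) = inv (eval ws)"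
proof (induction ws)
  case (Cons l ws)
  have "set (rev (map flip ws)) \<subseteq> S \<times> UNIV"
    using Cons.prems by simp
  then show ?case
    using Cons by (simp add: eval_append ev_flip inv_mult_group)
qed simp

lemma reduced_letters: "ws \<in> reduced_words S \<Longrightarrow> set ws \<subseteq> S \<times> UNIV"
  by (simp add: reduced_words_iff)

lemma nf:
  assumes "g \<in> carrier F"
  shows nf_reduced: "nf g \<in> reduced_words S" and eval_nf: "eval (nf g) = g"
proof -
  have "\<exists>!ws. ws \<in> reduced_words S \<and> eval ws = g"
    using basis assms by (simp add: free_basis_def)
  from theI'[OF this] show "nf g \<in> reduced_words S" "eval (nf g) = g"
    by (simp_all add: nf_def)
qed

lemma nf_letters: "g \<in> carrier F \<Longrightarrow> set (nf g) \<subseteq> S \<times> UNIV"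
  using nf_reduced reduced_letters by blast

lemma nf_eval: "ws \<in> reduced_words S \<Longrightarrow> nf (eval ws) = ws"
proof -
  assume ws: "ws \<in> reduced_words S"
  then have "\<exists>!vs. vs \<in> reduced_words S \<and> eval vs = eval ws"
    using basis reduced_letters by (simp add: free_basis_def)
  then show ?thesis
    using ws unfolding nf_def by (intro the1_equality) auto
qed

lemma len_eval: "ws \<in> reduced_words S \<Longrightarrow> len (eval ws) = length ws"
  by (simp add: len_nf nf_eval)

lemma nf_one [simp]: "nf \<one> = []"
  using nf_eval[of "[]"] by simp

lemma nf_eq_Nil_iff: "g \<in> carrier F \<Longrightarrow> nf g = [] \<longleftrightarrow> g = \<one>"
  by (metis eval_Nil eval_nf nf_one)

lemma len_eq_0_iff: "g \<in> carrier F \<Longrightarrow> len g = 0 \<longleftrightarrow> g = \<one>"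
  by (simp add: len_nf nf_eq_Nil_iff)

lemma nf_inj: "g \<in> carrier F \<Longrightarrow> h \<in> carrier F \<Longrightarrow> nf g = nf h \<Longrightarrow> g = h"
  by (metis eval_nf)

lemma nf_ev: "l \<in> S \<times> UNIV \<Longrightarrow> nf (ev l) = [l]"
  using nf_eval[of "[l]"] by (simp add: reduced_words_Cons)

lemma ev_inj: "l \<in> S \<times> UNIV \<Longrightarrow> m \<in> S \<times> UNIV \<Longrightarrow> ev l = ev m \<Longrightarrow> l = m"
  by (metis list.inject nf_ev)

lemma nf_mult:
  assumes "g \<in> carrier F" "h \<in> carrier F" "nf g @ nf h \<in> reduced_words S"
  shows "nf (g \<otimes> h) = nf g @ nf h"
proof -
  have "nf (eval (nf g @ nf h)) = nf g @ nf h"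
    using assms(3) by (rule nf_eval)
  then show ?thesis
    using assms by (simp add: eval_append nf_letters eval_nf)
qed

lemma nf_inv:
  assumes "g \<in> carrier F"
  shows "nf (inv g) = rev (map flip (nf g))"
  using nf_eval[OF reduced_words_rev_flip[OF nf_reduced[OF assms]]] assms
  by (simp add: eval_rev_flip nf_letters eval_nf)

lemma len_inv: "g \<in> carrier F \<Longrightarrow> len (inv g) = len g"
  by (simp add: len_nf nf_inv)

text \<open>At most one cancellation happens, since the tail left over is again reduced. The length
  bound \<open>len_eval_le\<close> and the homomorphism property of \<open>lift\<close> rest on this
  rule.\<close>

lemma nf_ev_mult:
  assumes "l \<in> S \<times> UNIV" "g \<in> carrier F"
  shows "nf (ev l \<otimes> g) = (if nf g \<noteq> [] \<and> hd (nf g) = flip l then tl (nf g) else l # nf g)"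
proof (cases "nf g \<noteq> [] \<and> hd (nf g) = flip l")
  case True
  then obtain vs where vs: "nf g = flip l # vs"
    by (cases "nf g") auto
  have red: "vs \<in> reduced_words S"
    using vs nf_reduced[OF assms(2)] by (simp add: reduced_words_Cons)
  have "g = ev (flip l) \<otimes> eval vs"
    using eval_nf[OF assms(2)] vs by simp
  then have "ev l \<otimes> g = eval vs"
    using assms(1) red
    by (simp add: ev_flip m_assoc[symmetric] reduced_letters)
  then show ?thesis
    using True vs red by (simp add: nf_eval)
next
  case False
  then have "l # nf g \<in> reduced_words S"
    using assms nf_reduced by (auto simp: reduced_words_Cons)
  from nf_eval[OF this] False assms show ?thesis
    by (auto simp: eval_nf)
qed

lemma len_eval_le: "set ws \<subseteq> S \<times> UNIV \<Longrightarrow> len (eval ws) \<le> length ws"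
  by (induction ws) (auto simp: len_nf nf_ev_mult)

lemma len_mult_le:
  assumes "g \<in> carrier F" "h \<in> carrier F"
  shows "len (g \<otimes> h) \<le> len g + len h"
  using len_eval_le[of "nf g @ nf h"] assms
  by (simp add: eval_append nf_letters eval_nf len_nf)

lemma len_ev: "l \<in> S \<times> UNIV \<Longrightarrow> len (ev l) = 1"
  by (simp add: len_nf nf_ev)

lemma word_induct [consumes 1, case_names one mult]:
  assumes "g \<in> carrier F" "P \<one>"
    and "\<And>l h. l \<in> S \<times> UNIV \<Longrightarrow> h \<in> carrier F \<Longrightarrow> P h \<Longrightarrow> P (ev l \<otimes> h)"
  shows "P g"
proof -
  have "P (eval ws)" if "set ws \<subseteq> S \<times> UNIV" for ws
    using that by (induction ws) (auto simp: assms)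
  from this[OF nf_letters[OF assms(1)]] show ?thesis
    by (simp add: eval_nf assms(1))
qed

subsection \<open>Universal property\<close>

text \<open>The endomorphism extending \<open>f\<close>. The relabelled word need not be reduced and
  its letters need not lie over \<open>S\<close>; \<open>ev\<close> still inverts the generator
  part, which is all that the evaluation requires.\<close>

definition lift :: "('a \<Rightarrow> 'a) \<Rightarrow> 'a \<Rightarrow> 'a" where
  "lift f g = eval (map (relabel f) (nf g))"

text \<open>When a letter cancels against the head of the normal form, the two relabelled letters
  are mutually inverse as well, so normalizing first does no harm.\<close>

lemma lift_ev_mult:
  assumes f: "f \<in> S \<rightarrow> carrier F" and l: "l \<in> S \<times> UNIV" and g: "g \<in> carrier F"
  shows "lift f (ev l \<otimes> g) = ev (relabel f l) \<otimes> lift f g"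
proof -
  have ec: "ev (relabel f m) \<in> carrier F" if "m \<in> S \<times> UNIV" for m
    using that f by (auto simp: ev_def relabel_def)
  have cl: "eval (map (relabel f) ws) \<in> carrier F" if "set ws \<subseteq> S \<times> UNIV" for ws
    using that by (induction ws) (auto simp: ec)
  show ?thesis
  proof (cases "nf g \<noteq> [] \<and> hd (nf g) = flip l")
    case True
    then obtain vs where vs: "nf g = flip l # vs"
      by (cases "nf g") auto
    have "set vs \<subseteq> S \<times> UNIV"
      using vs nf_letters[OF g] by simp
    moreover have "fst l \<in> S"
      using l by auto
    moreover have "ev (relabel f l) \<otimes> ev (f (fst l), \<not> snd l) = \<one>"
      using f l by (auto simp: ev_def relabel_def Pi_iff)
    ultimately show ?thesis
      using True vs l g ec[OF l] ec[of "flip l"] cl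
      by (simp add: lift_def nf_ev_mult flip_def relabel_def m_assoc[symmetric])
  next
    case False
    then have "nf (ev l \<otimes> g) = l # nf g"
      using nf_ev_mult[OF l g] by auto
    then show ?thesis
      by (simp add: lift_def)
  qed
qed

lemma lift_one [simp]: "lift f \<one> = \<one>"
  by (simp add: lift_def)

lemma lift_closed:
  assumes f: "f \<in> S \<rightarrow> carrier F" and "g \<in> carrier F"
  shows "lift f g \<in> carrier F"
  using assms(2)
proof (induction g rule: word_induct)
  case (mult l h)
  moreover have "ev (relabel f l) \<in> carrier F"
    using mult(1) f by (auto simp: ev_def relabel_def)
  ultimately show ?case
    using f by (simp add: lift_ev_mult)
qed simp

lemma lift_hom:
  assumes f: "f \<in> S \<rightarrow> carrier F"
  shows "lift f \<in> hom F F"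
proof (rule homI)
  fix g h assume h: "h \<in> carrier F"
  assume "g \<in> carrier F" then show "lift f (g \<otimes> h) = lift f g \<otimes> lift f h"
  proof (induction g rule: word_induct)
    case (mult l g)
    moreover have "ev (relabel f l) \<in> carrier F"
      using mult(1) f by (auto simp: ev_def relabel_def)
    ultimately show ?case
      using f h by (simp add: m_assoc lift_ev_mult lift_closed)
  qed (use f h in \<open>simp_all add: lift_closed\<close>)
qed (use f in \<open>auto simp: lift_closed\<close>)

lemma lift_gen:
  assumes f: "f \<in> S \<rightarrow> carrier F" and s: "s \<in> S"
  shows "lift f s = f s"
proof -
  have "nf s = [(s, True)]"
    using nf_ev[of "(s, True)"] s by (simp add: ev_def)
  then show ?thesis
    using f s by (auto simp: lift_def ev_def relabel_def Pi_iff)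
qed

lemma hom_ev:
  assumes "\<phi> \<in> hom F F" "l \<in> S \<times> UNIV"
  shows "\<phi> (ev l) = (if snd l then \<phi> (fst l) else inv (\<phi> (fst l)))"
proof -
  interpret group_hom F F \<phi>
    using assms(1) by unfold_locales
  show ?thesis
    using assms(2) S_closed by (auto simp: ev_def relabel_def)
qed

lemma hom_eqI:
  assumes "\<phi> \<in> hom F F" "\<psi> \<in> hom F F" "\<And>s. s \<in> S \<Longrightarrow> \<phi> s = \<psi> s" "g \<in> carrier F"
  shows "\<phi> g = \<psi> g"
  using assms(4)
proof (induction g rule: word_induct)
  case one
  then show ?case
    using assms(1,2) hom_one is_group by metis
next
  case (mult l h)
  then show ?case
    using assms(1-3) by (auto simp: hom_mult hom_ev)
qed

end

subsection \<open>Changing the basis\<close>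

lemma map_reduced_words_iff:
  assumes "inj_on f S" "set ws \<subseteq> S \<times> UNIV"
  shows "map (relabel f) ws \<in> reduced_words (f ` S) \<longleftrightarrow> ws \<in> reduced_words S"
  using assms(2)
proof (induction ws)
  case (Cons l ws)
  have "hd ws \<in> S \<times> UNIV" if "ws \<noteq> []"
    using Cons.prems that by (metis hd_in_set list.set_intros(2) subsetD)
  then have "hd (map (relabel f) ws) \<noteq> flip (relabel f l) \<longleftrightarrow> hd ws \<noteq> flip l"
    if "ws \<noteq> []"
    using that Cons.prems assms(1)
    by (auto simp: hd_map flip_def relabel_def prod_eq_iff mem_Times_iff inj_on_eq_iff)
  moreover have "relabel f l \<in> f ` S \<times> UNIV" "l \<in> S \<times> UNIV"
    using Cons.prems by (auto simp: mem_Times_iff relabel_def)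
  ultimately show ?case
    using Cons by (simp add: reduced_words_Cons)
qed simp

context based_free_group
begin

lemma eval_map_hom:
  assumes "\<phi> \<in> hom F F" "set ws \<subseteq> S \<times> UNIV"
  shows "eval (map (relabel \<phi>) ws) = \<phi> (eval ws)"
  using assms(2)
proof (induction ws)
  case (Cons l ws)
  have "ev (relabel \<phi> l) = \<phi> (ev l)"
    using hom_ev[OF assms(1), of l] Cons.prems by (simp add: ev_def relabel_def)
  then show ?case
    using Cons assms(1) by (simp add: hom_mult)
qed (use hom_one[OF assms(1) is_group is_group] in simp)

lemma iso_image_basis:
  assumes \<beta>: "\<beta> \<in> iso F F"
  shows "free_basis F (\<beta> ` S)"
    and "g \<in> carrier F \<Longrightarrow> word_length F (\<beta> ` S) (\<beta> g) = len g"
proof -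
  have hom: "\<beta> \<in> hom F F" and inj: "inj_on \<beta> (carrier F)" and surj: "\<beta> ` carrier F = carrier F"
    using \<beta> by (auto simp: iso_iff)
  have injS: "inj_on \<beta> S"
    using inj S_closed inj_on_subset by blast
  let ?M = "map (relabel \<beta>)"
  have red: "?M (nf g) \<in> reduced_words (\<beta> ` S)" "eval (?M (nf g)) = \<beta> g" if "g \<in> carrier F" for g
    using that by (auto simp: map_reduced_words_iff[OF injS] nf_letters nf_reduced
        eval_map_hom[OF hom] eval_nf)
  have uniq: "vs = ?M (nf g)"
    if "g \<in> carrier F" "vs \<in> reduced_words (\<beta> ` S)" "eval vs = \<beta> g" for g vs
  proof -
    have "(\<beta> ` S) \<times> UNIV = relabel \<beta> ` (S \<times> UNIV)"
      by (force simp: relabel_def)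
    then have "vs \<in> lists (relabel \<beta> ` (S \<times> UNIV))"
      using that(2) by (auto simp: reduced_words_iff subset_iff image_iff map_prod_def)
    then obtain ws where "vs = ?M ws" "ws \<in> lists (S \<times> UNIV)"
      unfolding lists_image by blast
    then have ws: "vs = ?M ws" "set ws \<subseteq> S \<times> UNIV"
      by (simp_all add: lists_eq_set)
    have "ws \<in> reduced_words S"
      using that(2) ws map_reduced_words_iff[OF injS] by blast
    then have "nf (eval ws) = ws"
      by (rule nf_eval)
    moreover have "\<beta> (eval ws) = \<beta> g"
      using that(3) ws by (simp add: eval_map_hom[OF hom])
    then have "eval ws = g"
      using that(1) ws(2) inj by (simp add: inj_on_eq_iff)
    ultimately show ?thesis
      using ws(1) by metis
  qed
  show basis': "free_basis F (\<beta> ` S)"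
    unfolding free_basis_def
  proof (intro conjI ballI)
    fix h assume "h \<in> carrier F"
    then have "h \<in> \<beta> ` carrier F"
      by (simp add: surj)
    then obtain g where g: "g \<in> carrier F" "h = \<beta> g"
      by auto
    show "\<exists>!vs. vs \<in> reduced_words (\<beta> ` S) \<and> eval vs = h"
    proof (rule ex1I[of _ "?M (nf g)"])
      show "?M (nf g) \<in> reduced_words (\<beta> ` S) \<and> eval (?M (nf g)) = h"
        using red[OF g(1)] g(2) by simp
    qed (use uniq[OF g(1)] g(2) in blast)
  next
    show "\<beta> ` S \<subseteq> carrier F"
      using S_closed surj by (metis image_mono)
  qed
  assume g: "g \<in> carrier F"
  have "(THE vs. vs \<in> reduced_words (\<beta> ` S) \<and> eval vs = \<beta> g) = ?M (nf g)"
    using red[OF g] uniq[OF g] by (intro the_equality) blast+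
  then show "word_length F (\<beta> ` S) (\<beta> g) = len g"
    by (simp add: word_length_def nf_def)
qed

text \<open>Passing from \<open>w\<close> to \<open>\<alpha> w\<close> amounts to measuring
  \<open>w\<close> in the basis that is the image of \<open>S\<close> under the inverse of
  \<open>\<alpha>\<close>, so minimality over bases becomes minimality over automorphic
  images.\<close>

lemma minimizing_len_le:
  assumes "minimizing_basis F S w" "\<alpha> \<in> iso F F" "w \<in> carrier F"
  shows "len w \<le> len (\<alpha> w)"
proof -
  define \<beta> where "\<beta> = inv_into (carrier F) \<alpha>"
  have "\<beta> \<in> iso F F"
    unfolding \<beta>_def using assms(2) by (rule iso_set_sym)
  moreover have "\<alpha> w \<in> carrier F" "\<beta> (\<alpha> w) = w"
    using assms(2,3) by (auto simp: \<beta>_def iso_iff)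
  ultimately show ?thesis
    using iso_image_basis[of \<beta>] assms(1) by (metis minimizing_basis_def)
qed

lemma conj_iso:
  assumes h: "h \<in> carrier F"
  shows "(\<lambda>g. inv h \<otimes> g \<otimes> h) \<in> iso F F"
proof (rule isoI)
  have cancel: "h \<otimes> (inv h \<otimes> g) = g" "inv h \<otimes> (h \<otimes> g) = g" if "g \<in> carrier F" for g
    using h that by (auto simp: m_assoc[symmetric])
  show "(\<lambda>g. inv h \<otimes> g \<otimes> h) \<in> hom F F"
    using h cancel by (auto intro!: homI simp: m_assoc)
  show "bij_betw (\<lambda>g. inv h \<otimes> g \<otimes> h) (carrier F) (carrier F)"
    using h cancel by (intro bij_betw_byWitness[where f' = "\<lambda>g. h \<otimes> g \<otimes> inv h"])
      (auto simp: m_assoc)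
qed

text \<open>Doubling every occurrence of \<open>s\<close> keeps a word reduced and can be undone, so
  the endomorphism squaring \<open>s\<close> acts on normal forms by the substitution
  \<open>D\<close>; this yields injectivity, and \<open>s\<close> itself is missed.\<close>

lemma generator_occurs:
  assumes w: "test_element_mono F w" and s: "s \<in> S"
  shows "s \<in> fst ` set (nf w)"
proof (rule ccontr)
  assume not: "s \<notin> fst ` set (nf w)"
  define f where "f = (\<lambda>t. if t = s then s \<otimes> s else t)"
  define D where "D = (\<lambda>l :: 'a \<times> bool. if fst l = s then [l, l] else [l])"
  have f: "f \<in> S \<rightarrow> carrier F"
    using S_closed s by (auto simp: f_def subset_iff)
  note hom = lift_hom[OF f]
  have gen: "lift f s = s \<otimes> s" "t \<in> S \<Longrightarrow> t \<noteq> s \<Longrightarrow> lift f t = t" for t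
    using lift_gen[OF f] s by (auto simp: f_def)
  have hd_D: "hd (concat (map D ws)) = hd ws" if "ws \<noteq> []" for ws
    using that by (cases ws) (auto simp: D_def)
  have D_Nil: "concat (map D ws) = [] \<longleftrightarrow> ws = []" for ws
    by (cases ws) (auto simp: D_def)
  have D_red: "concat (map D ws) \<in> reduced_words S" if "ws \<in> reduced_words S" for ws
    using that
  proof (induction ws)
    case (Cons l ws)
    then show ?case
      using hd_D[of ws] D_Nil[of ws] by (auto simp: D_def reduced_words_Cons)
  qed simp
  have D_eval: "eval (concat (map D ws)) = lift f (eval ws)" if "set ws \<subseteq> S \<times> UNIV" for ws
    using that
  proof (induction ws)
    case (Cons l ws)
    have "set (concat (map D ws)) \<subseteq> S \<times> UNIV"
      using Cons.prems by (auto simp: D_def split: if_splits)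
    moreover have "lift f (ev l) = eval (D l)"
    proof -
      have "l \<in> S \<times> UNIV" "fst l \<in> S" "fst l \<in> carrier F"
        using Cons.prems S_closed by (auto simp: mem_Times_iff)
      then show ?thesis
        using hom_ev[OF hom, of l] gen(1) gen(2)[of "fst l"]
        by (cases "fst l = s"; cases "snd l") (simp_all add: D_def ev_def inv_mult_group)
    qed
    moreover have "set (D l) \<subseteq> S \<times> UNIV"
      using Cons.prems by (auto simp: D_def)
    ultimately show ?case
      using Cons hom by (simp add: eval_append hom_mult)
  qed simp
  have nf_lift: "nf (lift f g) = concat (map D (nf g))" if "g \<in> carrier F" for g
    using nf_eval[OF D_red[OF nf_reduced[OF that]]] that
    by (simp add: D_eval nf_letters eval_nf)
  have D_inj: "us = vs" if "concat (map D us) = concat (map D vs)" for us vs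
    using that
  proof (induction us arbitrary: vs)
    case Nil
    then show ?case
      using D_Nil[of vs] by simp
  next
    case (Cons l us)
    then have "vs \<noteq> []"
      using D_Nil[of "l # us"] D_Nil[of vs] by auto
    then obtain m vs' where vs: "vs = m # vs'"
      by (cases vs) auto
    moreover have "l = m"
      using hd_D[of "l # us"] hd_D[of vs] Cons.prems vs by simp
    ultimately show ?case
      using Cons by simp
  qed
  have "inj_on (lift f) (carrier F)"
    using nf_lift D_inj nf_inj by (intro inj_onI) metis
  moreover have "lift f w = w"
  proof -
    have "w \<in> carrier F"
      using w by (simp add: test_element_mono_def)
    moreover have "concat (map D ws) = ws" if "s \<notin> fst ` set ws" for ws
      using that by (induction ws) (auto simp: D_def)
    ultimately show ?thesis
      using not nf_lift nf_inj f lift_closed by metis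
  qed
  ultimately have "lift f \<in> iso F F"
    using w hom by (auto simp: test_element_mono_def mon_def)
  then obtain g where g: "g \<in> carrier F" "lift f g = s"
    using s S_closed by (metis iso_iff imageE subsetD)
  have "nf s = [(s, True)]"
    using nf_ev[of "(s, True)"] s by (simp add: ev_def)
  then have "concat (map D (nf g)) = [(s, True)]"
    using g nf_lift by metis
  \<comment> \<open>A substituted word containing \<open>s\<close> has length at least two, so
    \<open>[(s, True)]\<close> is not of this form.\<close>
  then show False
    by (cases "nf g") (auto simp: D_def split: if_splits)
qed

subsection \<open>Whitehead automorphisms\<close>

text \<open>
  With \<open>c m = x\<close> for \<open>m \<in> Z\<close> and \<open>c m = 1\<close> otherwise, this is the Whitehead automorphism
  \<open>m \<mapsto> c(m) m c(m\<^sup>-\<^sup>1)\<^sup>-\<^sup>1\<close> with acting letter \<open>x\<close> and cut set \<open>Z\<close>; general powers \<open>c m\<close> of \<open>x\<close>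
  are allowed in order to cover its inverse.
\<close>

definition whitehead_map :: "'a \<times> bool \<Rightarrow> ('a \<times> bool \<Rightarrow> 'a) \<Rightarrow> 'a \<Rightarrow> 'a" where
  "whitehead_map x c s = (if s = fst x then s else c (s, True) \<otimes> s \<otimes> inv (c (s, False)))"

context
  fixes x :: "'a \<times> bool" and c :: "'a \<times> bool \<Rightarrow> 'a"
  assumes x: "x \<in> S \<times> UNIV" and c: "\<And>l. c l \<in> {\<one>, ev x, inv (ev x)}"
begin

lemma whitehead_factor_closed: "c l \<in> carrier F"
  using c[of l] x by auto

lemma whitehead_map_closed: "whitehead_map x c \<in> S \<rightarrow> carrier F"
  using S_closed by (auto simp: whitehead_map_def whitehead_factor_closed)

lemma lift_whitehead_map_x: "lift (whitehead_map x c) (ev x) = ev x"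
proof -
  have "fst x \<in> S"
    using x by (simp add: mem_Times_iff)
  then show ?thesis
    using hom_ev[OF lift_hom[OF whitehead_map_closed] x]
    by (simp add: lift_gen[OF whitehead_map_closed]) (simp add: whitehead_map_def ev_def)
qed

lemma lift_whitehead_map_power_x:
  assumes "y \<in> {\<one>, ev x, inv (ev x)}"
  shows "lift (whitehead_map x c) y = y"
proof -
  interpret h: group_hom F F "lift (whitehead_map x c)"
    using lift_hom[OF whitehead_map_closed] by unfold_locales
  show ?thesis
    using assms x lift_whitehead_map_x by (elim insertE emptyE) simp_all
qed

lemma lift_whitehead_map_ev:
  assumes "l \<in> S \<times> UNIV" "fst l \<noteq> fst x"
  shows "lift (whitehead_map x c) (ev l) = c l \<otimes> ev l \<otimes> inv (c (flip l))"
  using assms S_closed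
  by (subst hom_ev[OF lift_hom[OF whitehead_map_closed]])
    (auto simp: lift_gen[OF whitehead_map_closed] whitehead_map_def ev_def flip_def inv_mult_group m_assoc
      whitehead_factor_closed subset_iff)

end

text \<open>Both maps fix the factors \<open>c l\<close>, which are powers of \<open>x\<close>;
  hence the outer factors of the first map are simply cancelled by those of the second.\<close>

lemma lift_whitehead_map_inverse:
  assumes x: "x \<in> S \<times> UNIV" and c: "\<And>l. c l \<in> {\<one>, ev x, inv (ev x)}" and g: "g \<in> carrier F"
  shows "lift (whitehead_map x (\<lambda>l. inv (c l))) (lift (whitehead_map x c) g) = g"
proof -
  define d where "d = (\<lambda>l. inv (c l))"
  have d: "d l \<in> {\<one>, ev x, inv (ev x)}" for l
    using c[of l] x by (auto simp: d_def)
  note hc = lift_hom[OF whitehead_map_closed[of x c, OF x c]]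
    and hd = lift_hom[OF whitehead_map_closed[of x d, OF x d]]
  interpret D: group_hom F F "lift (whitehead_map x d)"
    using hd by unfold_locales
  have cl: "c l \<in> carrier F" for l
    using whitehead_factor_closed[of x c, OF x c] .
  have "(lift (whitehead_map x d) \<circ> lift (whitehead_map x c)) g = id g"
  proof (rule hom_eqI[OF Group.hom_compose[OF hc hd] _ _ g])
    fix s assume s: "s \<in> S"
    then have sF: "s \<in> carrier F"
      using S_closed by blast
    have evs: "ev (s, True) = s"
      by (simp add: ev_def)
    show "(lift (whitehead_map x d) \<circ> lift (whitehead_map x c)) s = id s"
    proof (cases "s = fst x")
      case True
      then show ?thesis
        using lift_gen[OF whitehead_map_closed[of x c, OF x c] s] lift_gen[OF whitehead_map_closed[of x d, OF x d] s]
        by (simp add: whitehead_map_def)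
    next
      case False
      have "lift (whitehead_map x c) s = c (s, True) \<otimes> s \<otimes> inv (c (s, False))"
        using lift_gen[OF whitehead_map_closed[of x c, OF x c] s] False by (simp add: whitehead_map_def)
      moreover have "lift (whitehead_map x d) s = inv (c (s, True)) \<otimes> s \<otimes> c (s, False)"
        using lift_gen[OF whitehead_map_closed[of x d, OF x d] s] False cl by (simp add: whitehead_map_def d_def)
      moreover have "lift (whitehead_map x d) (c l) = c l" for l
        using lift_whitehead_map_power_x[of x d, OF x d c] .
      moreover have "c l \<otimes> (inv (c l) \<otimes> h) = h" if "h \<in> carrier F" for l h
        using cl that by (simp add: m_assoc[symmetric])
      ultimately show ?thesis
        using sF cl by (simp add: m_assoc)
    qed
  qed (simp add: homI)
  then show ?thesis
    by (simp add: d_def)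
qed

lemma lift_whitehead_map_iso:
  assumes x: "x \<in> S \<times> UNIV" and c: "\<And>l. c l \<in> {\<one>, ev x, inv (ev x)}"
  shows "lift (whitehead_map x c) \<in> iso F F"
proof (rule isoI)
  define d where "d = (\<lambda>l. inv (c l))"
  have d: "d l \<in> {\<one>, ev x, inv (ev x)}" for l
    using c[of l] x by (auto simp: d_def)
  have "inv (d l) = c l" for l
    using whitehead_factor_closed[of x c, OF x c] by (simp add: d_def)
  then show "bij_betw (lift (whitehead_map x c)) (carrier F) (carrier F)"
    using lift_whitehead_map_inverse[OF x, of c] lift_whitehead_map_inverse[OF x, of d] c d
      lift_closed[OF whitehead_map_closed[of x c, OF x c]] lift_closed[OF whitehead_map_closed[of x d, OF x d]]
    by (intro bij_betw_byWitness[where f' = "lift (whitehead_map x d)"]) (auto simp: d_def)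
qed (rule lift_hom[OF whitehead_map_closed[of x c, OF x c]])

lemma eval_Suc:
  assumes "\<And>i. l i \<in> S \<times> UNIV"
  shows "eval (map l [0..<Suc m]) = eval (map l [0..<m]) \<otimes> ev (l m)"
  using assms by (simp add: eval_append image_subset_iff)

text \<open>
  For a letter of \<open>x\<close> itself the middle factor in \<open>c(m) m c(m\<^sup>-\<^sup>1)\<^sup>-\<^sup>1\<close> is trivial. Between
  consecutive letters the factors cancel unless the turn crosses \<open>Z\<close>, hence the two indicators.
\<close>

lemma whitehead_product:
  fixes l :: "nat \<Rightarrow> 'a \<times> bool"
  assumes l: "\<And>i. l i \<in> S \<times> UNIV" and x: "x \<in> S \<times> UNIV" "x \<in> Z" "flip x \<notin> Z"
  defines "c \<equiv> \<lambda>m. if m \<in> Z then ev x else \<one>"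
  shows "\<exists>R \<in> carrier F. lift (whitehead_map x c) (eval (map l [0..<n])) = c (l 0) \<otimes> R \<otimes> inv (c (l n)) \<and>
    len R \<le> (\<Sum>i<n. of_bool (fst (l i) \<noteq> fst x) + of_bool (flip (l i) \<in> Z \<longleftrightarrow> l (Suc i) \<notin> Z))"
proof (induction n)
  case 0
  have "c (l 0) \<in> carrier F"
    using x by (simp add: c_def)
  then have "lift (whitehead_map x c) (eval (map l [0..<0])) = c (l 0) \<otimes> \<one> \<otimes> inv (c (l 0)) \<and> len \<one> \<le> 0"
    by (simp add: len_nf)
  then show ?case
    by (intro bexI[of _ \<one>]) simp_all
next
  case (Suc n)
  define \<sigma> where "\<sigma> = lift (whitehead_map x c)"
  have c: "c m \<in> {\<one>, ev x, inv (ev x)}" for m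
    by (simp add: c_def)
  have hom: "\<sigma> \<in> hom F F"
    unfolding \<sigma>_def by (rule lift_hom[OF whitehead_map_closed[of x c, OF x(1) c]])
  have cl: "c m \<in> carrier F" for m
    by (rule whitehead_factor_closed[of x c, OF x(1) c])
  \<comment> \<open>The middle factor: a letter over \<open>x\<close> is absorbed by the outer
    factors and costs nothing.\<close>
  define y where "y = (if fst (l n) = fst x then \<one> else ev (l n))"
  have y: "y \<in> carrier F" "len y \<le> of_bool (fst (l n) \<noteq> fst x)"
    using l[of n] by (auto simp: y_def len_ev len_nf[of \<one>])
  have \<sigma>l: "\<sigma> (ev (l n)) = c (l n) \<otimes> y \<otimes> inv (c (flip (l n)))"
  proof (cases "fst (l n) = fst x")
    case True
    then consider "l n = x" | "l n = flip x"
      by (auto simp: fst_eq_iff_flip)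
    then have "\<sigma> (ev (l n)) = ev (l n)"
      by cases (use x lift_whitehead_map_power_x[of x c, OF x(1) c] in \<open>auto simp: \<sigma>_def ev_flip\<close>)
    then show ?thesis
      using True x by (auto simp: fst_eq_iff_flip y_def c_def ev_flip)
  next
    case False
    then show ?thesis
      using lift_whitehead_map_ev[of x c, OF x(1) c l] by (simp add: y_def \<sigma>_def)
  qed
  \<comment> \<open>The factor at the turn between two consecutive letters: trivial if both
    directions lie on the same side of \<open>Z\<close>, otherwise \<open>x\<close> or its
    inverse.\<close>
  define z where "z = inv (c (flip (l n))) \<otimes> c (l (Suc n))"
  have z: "z \<in> carrier F" "len z \<le> of_bool (flip (l n) \<in> Z \<longleftrightarrow> l (Suc n) \<notin> Z)"
    using x cl by (auto simp: z_def c_def len_ev len_inv len_nf[of \<one>])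
  obtain R where R: "R \<in> carrier F" "\<sigma> (eval (map l [0..<n])) = c (l 0) \<otimes> R \<otimes> inv (c (l n))"
      "len R \<le> (\<Sum>i<n. of_bool (fst (l i) \<noteq> fst x) + of_bool (flip (l i) \<in> Z \<longleftrightarrow> l (Suc i) \<notin> Z))"
    using Suc unfolding \<sigma>_def by blast
  have cancel: "inv (c m) \<otimes> (c m \<otimes> h) = h" if "h \<in> carrier F" for m h
    using cl that by (simp add: m_assoc[symmetric])
  have cz: "inv (c (flip (l n))) = z \<otimes> inv (c (l (Suc n)))"
    using cl by (simp add: z_def m_assoc)
  have "eval (map l [0..<n]) \<in> carrier F"
    using l by (simp add: image_subset_iff)
  then have "\<sigma> (eval (map l [0..<Suc n])) = c (l 0) \<otimes> R \<otimes> inv (c (l n)) \<otimes> (c (l n) \<otimes> y \<otimes> (z \<otimes> inv (c (l (Suc n)))))"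
    unfolding eval_Suc[OF l] using hom l by (simp only: hom_mult ev_closed \<sigma>l R(2) cz[symmetric])
  also have "\<dots> = c (l 0) \<otimes> (R \<otimes> (y \<otimes> z)) \<otimes> inv (c (l (Suc n)))"
    using R(1) y(1) z(1) cl cancel by (simp add: m_assoc)
  finally have eq: "\<sigma> (eval (map l [0..<Suc n])) = \<dots>" .
  have "len (R \<otimes> (y \<otimes> z)) \<le> len R + (len y + len z)"
    using len_mult_le[OF R(1), of "y \<otimes> z"] len_mult_le[OF y(1) z(1)] y(1) z(1) by simp
  then have "len (R \<otimes> (y \<otimes> z)) \<le>
      (\<Sum>i<Suc n. of_bool (fst (l i) \<noteq> fst x) + of_bool (flip (l i) \<in> Z \<longleftrightarrow> l (Suc i) \<notin> Z))"
    using R(3) y(2) z(2) by simp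
  then show ?case
    using eq R(1) y(1) z(1) unfolding \<sigma>_def by blast
qed

text \<open>The automorphism saves the letters over \<open>x\<close> and pays one letter for each
  turn crossing \<open>Z\<close>. As the word is cyclic (\<open>l n = l 0\<close>), the two outer
  factors agree and a conjugation removes them; by minimality the saving cannot exceed the
  cost.\<close>

lemma whitehead_inequality:
  fixes l :: "nat \<Rightarrow> 'a \<times> bool"
  assumes min: "minimizing_basis F S w" and w: "w = eval (map l [0..<n])" "len w = n" "l n = l 0"
    and l: "\<And>i. l i \<in> S \<times> UNIV" and x: "x \<in> S \<times> UNIV" "x \<in> Z" "flip x \<notin> Z"
  shows "card {i. i < n \<and> fst (l i) = fst x} \<le> card {i. i < n \<and> (flip (l i) \<in> Z \<longleftrightarrow> l (Suc i) \<notin> Z)}"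
proof -
  define c where "c = (\<lambda>m. if m \<in> Z then ev x else \<one>)"
  define \<sigma> where "\<sigma> = lift (whitehead_map x c)"
  have c: "c m \<in> {\<one>, ev x, inv (ev x)}" for m
    by (simp add: c_def)
  have cl: "c m \<in> carrier F" for m
    by (rule whitehead_factor_closed[of x c, OF x(1) c])
  have wF: "w \<in> carrier F"
    using w(1) l by (simp add: image_subset_iff)
  have iso: "\<sigma> \<in> iso F F"
    unfolding \<sigma>_def by (rule lift_whitehead_map_iso[of x c, OF x(1) c])
  have "\<exists>R \<in> carrier F. \<sigma> (eval (map l [0..<n])) = c (l 0) \<otimes> R \<otimes> inv (c (l n)) \<and>
      len R \<le> (\<Sum>i<n. of_bool (fst (l i) \<noteq> fst x) + of_bool (flip (l i) \<in> Z \<longleftrightarrow> l (Suc i) \<notin> Z))"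
    unfolding \<sigma>_def c_def by (rule whitehead_product[OF l x])
  then obtain R where R: "R \<in> carrier F"
      "\<sigma> (eval (map l [0..<n])) = c (l 0) \<otimes> R \<otimes> inv (c (l n))"
      "len R \<le> (\<Sum>i<n. of_bool (fst (l i) \<noteq> fst x) + of_bool (flip (l i) \<in> Z \<longleftrightarrow> l (Suc i) \<notin> Z))"
    by blast
  have \<sigma>w: "\<sigma> w = c (l 0) \<otimes> R \<otimes> inv (c (l 0))"
    using R(2) by (simp only: w(1) w(3))
  have "n \<le> len (((\<lambda>g. inv (c (l 0)) \<otimes> g \<otimes> c (l 0)) \<circ> \<sigma>) w)"
    using minimizing_len_le[OF min iso_set_trans[OF iso conj_iso[OF cl]] wF] w(2) by metis
  also have "((\<lambda>g. inv (c (l 0)) \<otimes> g \<otimes> c (l 0)) \<circ> \<sigma>) w = R"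
    using R(1) cl by (simp add: \<sigma>w m_assoc inv_solve_left')
  also have "len R \<le> card {i. i < n \<and> fst (l i) \<noteq> fst x} +
      card {i. i < n \<and> (flip (l i) \<in> Z \<longleftrightarrow> l (Suc i) \<notin> Z)}"
    using R(3) by (simp add: sum.distrib of_bool_def sum.If_cases lessThan_def Collect_conj_eq)
  finally have "n \<le> card {i. i < n \<and> fst (l i) \<noteq> fst x} +
      card {i. i < n \<and> (flip (l i) \<in> Z \<longleftrightarrow> l (Suc i) \<notin> Z)}" .
  moreover have "n = card {i. i < n \<and> fst (l i) = fst x} + card {i. i < n \<and> fst (l i) \<noteq> fst x}"
  proof -
    have "{..<n} = {i. i < n \<and> fst (l i) = fst x} \<union> {i. i < n \<and> fst (l i) \<noteq> fst x}"
      by auto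
    then show ?thesis
      by (metis (no_types, lifting) card_Un_disjoint card_lessThan disjoint_iff finite_Un
          finite_lessThan mem_Collect_eq)
  qed
  ultimately show ?thesis
    by linarith
qed


text \<open>
  The turns \<open>{flip (l i), l (Suc i)}\<close> of the cyclic word \<open>w\<close> are the edges of its Whitehead graph,
  and \<open>A\<close>, \<open>B\<close> partition the complement of a vertex \<open>x\<close>. If no edge joins \<open>A\<close> and \<open>B\<close>, then
  either \<open>insert x A\<close> (with acting letter \<open>x\<close>) or \<open>A\<close> (with an acting letter in \<open>A\<close>) violates
  the Whitehead inequality, or \<open>A\<close> is a symmetric union of components and \<open>w\<close> misses a generator.
\<close>

lemma whitehead_graph_aux:
  fixes l :: "nat \<Rightarrow> 'a \<times> bool"
  assumes min: "minimizing_basis F S w" and w: "w = eval (map l [0..<n])" "len w = n" "l n = l 0"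
    and l: "\<And>i. l i \<in> S \<times> UNIV" and occ: "\<And>s. s \<in> S \<Longrightarrow> \<exists>i<n. fst (l i) = s"
    and x: "x \<in> S \<times> UNIV" and AB: "A \<union> B = S \<times> UNIV - {x}" "A \<inter> B = {}" "A \<noteq> {}"
    and xB: "flip x \<in> B"
  shows "\<exists>i<n. flip (l i) \<in> A \<and> l (Suc i) \<in> B \<or> flip (l i) \<in> B \<and> l (Suc i) \<in> A"
proof (rule ccontr)
  assume neg: "\<not> ?thesis"
  have cover: "m = x \<or> m \<in> A \<or> m \<in> B" if "m \<in> S \<times> UNIV" for m
    using that AB(1) by blast
  have fl: "flip (l i) \<in> S \<times> UNIV" for i
    using l[of i] by simp
  have notA: "x \<notin> A" "flip x \<notin> A" "x \<notin> B"
    using AB xB by auto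
  have A_sub: "A \<subseteq> S \<times> UNIV"
    using AB(1) by blast
  note ineq = whitehead_inequality[OF min w l]
  show False
  proof (cases "\<exists>i<n. flip (l i) = x \<and> l (Suc i) \<in> A \<or> flip (l i) \<in> A \<and> l (Suc i) = x")
    case True
    then obtain j where j: "j < n" "flip (l j) = x \<and> l (Suc j) \<in> A \<or> flip (l j) \<in> A \<and> l (Suc j) = x"
      by blast
    \<comment> \<open>Without edges between \<open>A\<close> and \<open>B\<close>, a turn crossing
      \<open>?Z\<close> must involve \<open>x\<close>, while turn \<open>j\<close> involves
      \<open>x\<close> without crossing. So the crossings are strictly fewer than the turns at
      \<open>x\<close>, whose number is at most the number of letters over \<open>x\<close>.\<close>
    let ?Z = "insert x A"
    let ?C = "{i. i < n \<and> (flip (l i) \<in> ?Z \<longleftrightarrow> l (Suc i) \<notin> ?Z)}"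
    let ?X = "{i. i < n \<and> (flip (l i) = x \<or> l (Suc i) = x)}"
    have "?C \<subseteq> ?X - {j}"
    proof
      fix i assume i: "i \<in> ?C"
      then have "\<not> (flip (l i) \<in> A \<and> l (Suc i) \<in> B \<or> flip (l i) \<in> B \<and> l (Suc i) \<in> A)"
        using neg by blast
      moreover have "i \<noteq> j"
        using i j by auto
      ultimately show "i \<in> ?X - {j}"
        using i cover[OF fl[of i]] cover[OF l[of "Suc i"]] by blast
    qed
    moreover have "j \<in> ?X"
      using j by auto
    ultimately have "card ?C < card ?X"
      by (intro psubset_card_mono) auto
    also have "card ?X \<le> card {i. i < n \<and> flip (l i) = x} + card {i. i < n \<and> l (Suc i) = x}"
      by (rule order_trans[OF _ card_Un_le]) (auto intro!: card_mono)
    \<comment> \<open>Reading each turn at its second letter shifts the index by one;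
      \<open>l n = l 0\<close> closes the shift.\<close>
    also have "card {i. i < n \<and> l (Suc i) = x} = card {i. i < n \<and> l i = x}"
    proof -
      have cs: "card {i. i < n \<and> P i} = (\<Sum>i<n. of_bool (P i))" for P
        by (simp add: of_bool_def sum.If_cases lessThan_def Collect_conj_eq)
      have "(\<Sum>i<Suc n. of_bool (l i = x)) = of_bool (l 0 = x) + (\<Sum>i<n. of_bool (l (Suc i) = x) :: nat)"
        by (rule sum.lessThan_Suc_shift)
      then show ?thesis
        using w(3) by (simp add: cs)
    qed
    also have "card {i. i < n \<and> flip (l i) = x} + card {i. i < n \<and> l i = x} =
        card {i. i < n \<and> fst (l i) = fst x}"
      by (subst card_Un_disjoint[symmetric])
        (auto simp: flip_eq_iff fst_eq_iff_flip intro!: arg_cong[of _ _ card])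
    finally show False
      using ineq[of x ?Z, OF x] notA by simp
  next
    case False
    \<comment> \<open>No turn leaves \<open>A\<close>, neither to \<open>B\<close> nor to
      \<open>x\<close>, so \<open>A\<close> is a union of components.\<close>
    have closed: "flip (l i) \<in> A \<longleftrightarrow> l (Suc i) \<in> A" if "i < n" for i
      using False neg that cover[OF fl[of i]] cover[OF l[of "Suc i"]] by blast
    show False
    proof (cases "\<exists>y \<in> A. flip y \<notin> A")
      case True
      then obtain y where y: "y \<in> A" "flip y \<notin> A"
        by blast
      then have yS: "y \<in> S \<times> UNIV"
        using A_sub by blast
      have "{i. i < n \<and> (flip (l i) \<in> A \<longleftrightarrow> l (Suc i) \<notin> A)} = {}"
        using closed by blast
      then have "card {i. i < n \<and> fst (l i) = fst y} \<le> 0"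
        using ineq[of y A, OF yS y] by (metis card.empty)
      moreover have "fst y \<in> S"
        using yS by (simp add: mem_Times_iff)
      then obtain i where "i < n" "fst (l i) = fst y"
        using occ by blast
      ultimately show False
        by auto
    next
      case sym: False
      then have sym: "flip m \<in> A \<longleftrightarrow> m \<in> A" for m
        by (metis flip_flip)
      \<comment> \<open>Crossing a letter preserves membership in \<open>A\<close> by symmetry, and
        crossing a turn preserves it by \<open>closed\<close>; so all letters of \<open>w\<close>
        lie in \<open>A\<close> or none does, although both \<open>x\<close> outside
        \<open>A\<close> and \<open>y\<close> in \<open>A\<close> must occur up to
        inversion.\<close>
      have const: "l i \<in> A \<longleftrightarrow> l 0 \<in> A" if "i \<le> n" for i
        using that by (induction i) (auto simp: closed[symmetric] sym)
      obtain y where y: "y \<in> A"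
        using AB(3) by blast
      then have "fst x \<in> S" "fst y \<in> S"
        using x A_sub by (auto simp: mem_Times_iff)
      then obtain i j where "i < n" "fst (l i) = fst x" "j < n" "fst (l j) = fst y"
        using occ by meson
      then have "l i \<notin> A" "l j \<in> A"
        using notA y sym[of x] sym[of y] by (auto simp: fst_eq_iff_flip)
      then show False
        using const[of i] const[of j] \<open>i < n\<close> \<open>j < n\<close> by simp
    qed
  qed
qed

text \<open>The inverse of \<open>x\<close> differs from \<open>x\<close>, so it lies in one of the
  two parts; the conclusion is symmetric in \<open>A\<close> and \<open>B\<close>, and that part may
  be taken for \<open>B\<close>.\<close>

lemma whitehead_graph_no_cut_vertex:
  fixes l :: "nat \<Rightarrow> 'a \<times> bool"
  assumes min: "minimizing_basis F S w" and w: "w = eval (map l [0..<n])" "len w = n" "l n = l 0"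
    and l: "\<And>i. l i \<in> S \<times> UNIV" and occ: "\<And>s. s \<in> S \<Longrightarrow> \<exists>i<n. fst (l i) = s"
    and x: "x \<in> S \<times> UNIV" and AB: "A \<union> B = S \<times> UNIV - {x}" "A \<inter> B = {}" "A \<noteq> {}" "B \<noteq> {}"
  shows "\<exists>i<n. flip (l i) \<in> A \<and> l (Suc i) \<in> B \<or> flip (l i) \<in> B \<and> l (Suc i) \<in> A"
proof -
  have "flip x \<in> A \<or> flip x \<in> B"
    using x AB(1) by (metis Diff_iff UnE flip_mem_iff flip_neq(1) singletonD)
  then show ?thesis
  proof
    assume "flip x \<in> B"
    from whitehead_graph_aux[OF min w l occ x AB(1-3) this] show ?thesis .
  next
    assume "flip x \<in> A"
    moreover have "B \<union> A = S \<times> UNIV - {x}" "B \<inter> A = {}"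
      using AB by auto
    ultimately show ?thesis
      using whitehead_graph_aux[OF min w l occ x _ _ AB(4)] by blast
  qed
qed

end

subsection \<open>Almost invariant sets from monomorphisms\<close>

lemma mon_funpow:
  assumes "\<phi> \<in> mon G G"
  shows "(\<phi> ^^ n) \<in> mon G G"
proof (induction n)
  case 0
  show ?case
    by (simp add: mon_def hom_def)
next
  case (Suc n)
  have "\<phi> \<circ> (\<phi> ^^ n) \<in> hom G G"
    using Suc assms by (auto simp: mon_def intro: Group.hom_compose)
  moreover have "inj_on (\<phi> \<circ> (\<phi> ^^ n)) (carrier G)"
    using Suc assms by (intro comp_inj_on) (auto simp: mon_def hom_def image_subset_iff
        intro: inj_on_subset)
  ultimately show ?case
    by (simp add: mon_def o_def)
qed

context based_free_group
begin

section \<open>Half-trees at the identity and paths that cross their boundary\<close>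

definition cone :: "'a \<times> bool \<Rightarrow> 'a set" where
  "cone l = {y \<in> carrier F. nf y \<noteq> [] \<and> hd (nf y) = l}"

lemma nf_mult_ev:
  assumes "m \<in> S \<times> UNIV" "g \<in> carrier F"
  shows "nf (g \<otimes> ev m) =
    (if nf g \<noteq> [] \<and> last (nf g) = flip m then butlast (nf g) else nf g @ [m])"
proof (cases "nf g \<noteq> [] \<and> last (nf g) = flip m")
  case True
  then have vs: "nf g = butlast (nf g) @ [flip m]"
    by (metis append_butlast_last_id)
  then have red: "butlast (nf g) \<in> reduced_words S"
    by (metis nf_reduced[OF assms(2)] reduced_words_append)
  have "g = eval (butlast (nf g) @ [flip m])"
    using vs eval_nf[OF assms(2)] by simp
  also have "\<dots> = eval (butlast (nf g)) \<otimes> inv (ev m)"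
    using assms(1) red by (simp add: eval_append reduced_letters ev_flip)
  finally have "g \<otimes> ev m = eval (butlast (nf g)) \<otimes> inv (ev m) \<otimes> ev m"
    by simp
  also have "\<dots> = eval (butlast (nf g))"
    using assms(1) red by (simp add: m_assoc reduced_letters)
  finally show ?thesis
    using True red by (simp add: nf_eval)
next
  case False
  then have "nf g @ [m] \<in> reduced_words S"
    using assms nf_reduced[OF assms(2)]
    by (auto simp: reduced_words_append reduced_words_Cons flip_eq_iff)
  from nf_eval[OF this] False assms show ?thesis
    by (auto simp: eval_append nf_letters eval_nf)
qed

text \<open>Multiplying on the right by a letter changes a reduced word at its end only, so its
  first letter can change only when one of the two words is empty.\<close>

lemma cone_crossing_ev:
  assumes "m \<in> S \<times> UNIV" "y \<in> carrier F" "y \<in> cone l \<longleftrightarrow> y \<otimes> ev m \<notin> cone l"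
  shows "y = \<one> \<or> y \<otimes> ev m = \<one>"
proof (rule ccontr)
  assume "\<not> ?thesis"
  then have "nf y \<noteq> []" "nf (y \<otimes> ev m) \<noteq> []"
    using assms(1,2) by (auto simp: nf_eq_Nil_iff)
  then have "hd (nf (y \<otimes> ev m)) = hd (nf y)"
    using assms(1,2) by (auto simp: nf_mult_ev split: if_splits)
      (metis append_butlast_last_id hd_append2)
  then show False
    using assms \<open>nf y \<noteq> []\<close> \<open>nf (y \<otimes> ev m) \<noteq> []\<close> by (simp add: cone_def)
qed

text \<open>The path from \<open>y\<close> spelled by \<open>ws\<close> can change sides only
  through the vertex 1. Applied with \<open>y\<close> of the form \<open>inv v \<otimes> g\<close>,
  this says that a path separated by an edge at \<open>v\<close> passes through
  \<open>v\<close>.\<close>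

lemma cone_crossing:
  assumes "set ws \<subseteq> S \<times> UNIV" "y \<in> carrier F" "y \<in> cone l \<longleftrightarrow> y \<otimes> eval ws \<notin> cone l"
  shows "\<exists>k \<le> length ws. y \<otimes> eval (take k ws) = \<one>"
  using assms
proof (induction ws arbitrary: y)
  case (Cons m ws)
  show ?case
  proof (cases "y \<in> cone l \<longleftrightarrow> y \<otimes> ev m \<notin> cone l")
    case True
    then have "y = \<one> \<or> y \<otimes> ev m = \<one>"
      using cone_crossing_ev Cons.prems by simp
    then show ?thesis
    proof
      assume "y = \<one>"
      then show ?thesis
        by (intro exI[of _ 0]) simp
    next
      assume "y \<otimes> ev m = \<one>"
      then show ?thesis
        using Cons.prems by (intro exI[of _ 1]) simp
    qed
  next
    case False
    then have "y \<otimes> ev m \<in> cone l \<longleftrightarrow> y \<otimes> ev m \<otimes> eval ws \<notin> cone l"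
      using Cons.prems by (simp add: m_assoc)
    then obtain k where "k \<le> length ws" "y \<otimes> ev m \<otimes> eval (take k ws) = \<one>"
      using Cons.IH[of "y \<otimes> ev m"] Cons.prems by auto
    moreover have "set (take k ws) \<subseteq> S \<times> UNIV"
      using Cons.prems set_take_subset[of k ws] by (auto simp del: mem_Sigma_iff)
    ultimately show ?thesis
      using Cons.prems by (intro exI[of _ "Suc k"]) (simp add: m_assoc)
  qed
qed simp

lemma take_nf_letters: "g \<in> carrier F \<Longrightarrow> set (take k (nf g)) \<subseteq> S \<times> UNIV"
  using nf_letters set_take_subset by (metis subset_trans)

lemma finite_ball:
  assumes "finite S"
  shows "finite {g \<in> carrier F. len g \<le> n}"
proof (rule finite_imageD)
  show "finite (nf ` {g \<in> carrier F. len g \<le> n})"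
    by (rule finite_subset[OF _ finite_lists_length_le[of "S \<times> UNIV" n]])
      (use assms nf_letters in \<open>auto simp: len_nf simp del: mem_Sigma_iff\<close>)
qed (auto intro: inj_onI nf_inj)

text \<open>Finite symmetric difference with right translates. Requiring it for every
  \<open>f\<close>, not only for generators, allows direct use with \<open>f\<close> a vertex of a
  line.\<close>

definition almost_invariant :: "'a set \<Rightarrow> bool" where
  "almost_invariant P \<longleftrightarrow>
     (\<forall>f \<in> carrier F. finite {g \<in> carrier F. g \<in> P \<longleftrightarrow> g \<otimes> f \<notin> P})"

text \<open>If \<open>g\<close> and \<open>g \<otimes> f\<close> are on different sides, then
  \<open>v\<close> lies on the path from \<open>\<psi> g\<close> spelled by the normal form of
  \<open>\<psi> f\<close>. This leaves one candidate for \<open>\<psi> g\<close> per position on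
  that path, and injectivity leaves at most one \<open>g\<close> for each candidate.\<close>

lemma almost_invariant_pullback_cone:
  assumes \<psi>: "\<psi> \<in> mon F F" and v: "v \<in> carrier F"
  shows "almost_invariant {g \<in> carrier F. inv v \<otimes> \<psi> g \<in> cone l}"
  unfolding almost_invariant_def
proof
  fix f assume f: "f \<in> carrier F"
  have hom: "\<psi> \<in> hom F F" and inj: "inj_on \<psi> (carrier F)"
    using \<psi> by (auto simp: mon_def)
  have \<psi>_cl: "\<psi> g \<in> carrier F" if "g \<in> carrier F" for g
    using hom that by (rule hom_in_carrier)
  let ?P = "{g \<in> carrier F. inv v \<otimes> \<psi> g \<in> cone l}"
  let ?B = "{g \<in> carrier F. g \<in> ?P \<longleftrightarrow> g \<otimes> f \<notin> ?P}"
  let ?u = "\<lambda>k. eval (take k (nf (\<psi> f)))"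
  have u: "?u k \<in> carrier F" for k
    using f by (intro eval_closed take_nf_letters \<psi>_cl)
  have "\<psi> ` ?B \<subseteq> (\<lambda>k. v \<otimes> inv (?u k)) ` {..length (nf (\<psi> f))}"
  proof
    fix y assume "y \<in> \<psi> ` ?B"
    then obtain g where g: "g \<in> carrier F" "y = \<psi> g"
        "inv v \<otimes> \<psi> g \<in> cone l \<longleftrightarrow> inv v \<otimes> \<psi> (g \<otimes> f) \<notin> cone l"
      using f by auto
    then have "inv v \<otimes> \<psi> g \<in> cone l \<longleftrightarrow> inv v \<otimes> \<psi> g \<otimes> eval (nf (\<psi> f)) \<notin> cone l"
      using f v hom by (simp add: hom_mult eval_nf \<psi>_cl m_assoc)
    then obtain k where k: "k \<le> length (nf (\<psi> f))" "inv v \<otimes> \<psi> g \<otimes> ?u k = \<one>"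
      using cone_crossing[of "nf (\<psi> f)" "inv v \<otimes> \<psi> g" l] f v g
      by (auto simp: nf_letters \<psi>_cl)
    have "inv v \<otimes> \<psi> g = inv (?u k)"
      using k(2) u v g by (intro inv_equality[symmetric]) (auto simp: \<psi>_cl)
    then have "\<psi> g = v \<otimes> inv (?u k)"
      using u v g by (metis \<psi>_cl inv_closed inv_solve_left)
    then show "y \<in> (\<lambda>k. v \<otimes> inv (?u k)) ` {..length (nf (\<psi> f))}"
      using g(2) k(1) by blast
  qed
  then have "finite (\<psi> ` ?B)"
    by (rule finite_subset) simp
  then show "finite ?B"
    by (rule finite_imageD) (use inj in \<open>auto intro: inj_on_subset\<close>)
qed

text \<open>Cancelling \<open>\<phi>^n\<close> on both sides turns equality of the two images into
  surjectivity of \<open>\<phi>^(m - n)\<close>, hence of \<open>\<phi>\<close>.\<close>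

lemma mon_image_chain_collapse:
  assumes \<phi>: "\<phi> \<in> mon F F" and eq: "(\<phi> ^^ n) ` carrier F = (\<phi> ^^ m) ` carrier F" and "n < m"
  shows "\<phi> \<in> iso F F"
proof -
  have hom: "\<phi> \<in> hom F F" and inj: "inj_on \<phi> (carrier F)"
    using \<phi> by (auto simp: mon_def)
  have pow_cl: "(\<phi> ^^ k) g \<in> carrier F" if "g \<in> carrier F" for k g
    using mon_funpow[OF \<phi>, of k] that by (auto simp: mon_def hom_def)
  have "carrier F \<subseteq> \<phi> ` carrier F"
  proof
    fix g assume g: "g \<in> carrier F"
    then obtain h where h: "h \<in> carrier F" "(\<phi> ^^ n) g = (\<phi> ^^ m) h"
      using eq by (metis imageE imageI)
    define k where "k = m - n - 1"
    have "m = n + Suc k"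
      using assms(3) by (simp add: k_def)
    then have "(\<phi> ^^ n) g = (\<phi> ^^ n) ((\<phi> ^^ Suc k) h)"
      using h(2) by (simp only: funpow_add o_apply)
    moreover have "inj_on (\<phi> ^^ n) (carrier F)"
      using mon_funpow[OF \<phi>, of n] by (simp add: mon_def)
    ultimately have "g = (\<phi> ^^ Suc k) h"
      using g pow_cl[OF h(1), of "Suc k"] by (metis inj_onD)
    then show "g \<in> \<phi> ` carrier F"
      using pow_cl[OF h(1), of k] by simp
  qed
  then have "\<phi> ` carrier F = carrier F"
    using hom by (auto simp: hom_def)
  then show ?thesis
    using hom inj by (simp add: iso_iff)
qed

text \<open>Walking from 1 to \<open>h\<close>, every vertex lies on a translate by \<open>H\<close>
  of the segment from 1 to \<open>a\<close>. The translating elements of consecutive vertices differ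
  by an element of \<open>H\<close> that runs along part of a segment, one edge, and part of a
  segment again: length at most \<open>2 |a| + 1\<close>.\<close>

lemma subgroup_generated_by_ball:
  assumes H: "subgroup H F" and a: "a \<in> carrier F"
    and cov: "\<And>h k. h \<in> H \<Longrightarrow> \<exists>h' \<in> H. \<exists>j. eval (take k (nf h)) = h' \<otimes> eval (take j (nf a))"
  shows "H = generate F (H \<inter> {g \<in> carrier F. len g \<le> 2 * len a + 1})"
proof
  let ?B = "H \<inter> {g \<in> carrier F. len g \<le> 2 * len a + 1}"
  let ?u = "\<lambda>j. eval (take j (nf a))"
  interpret H: subgroup H F
    by (rule H)
  have gen_sub: "generate F ?B \<subseteq> H"
    by (rule generate_subgroup_incl[OF _ H]) blast
  then show "generate F ?B \<subseteq> H" .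
  have u: "?u j \<in> carrier F" "len (?u j) \<le> len a" for j
    using a len_eval_le[OF take_nf_letters[OF a], of j] by (auto simp: take_nf_letters len_nf)
  show "H \<subseteq> generate F ?B"
  proof
    fix h assume h: "h \<in> H"
    then have hF: "h \<in> carrier F"
      by simp
    have "\<exists>h' \<in> generate F ?B. \<exists>j. eval (take k (nf h)) = h' \<otimes> ?u j" if "k \<le> length (nf h)" for k
      using that
    proof (induction k)
      case 0
      then show ?case
        by (intro bexI[of _ \<one>] exI[of _ 0]) (auto intro: generate.one)
    next
      case (Suc k)
      then obtain h' j where h': "h' \<in> generate F ?B" "eval (take k (nf h)) = h' \<otimes> ?u j"
        by auto
      obtain h'' j' where h'': "h'' \<in> H" "eval (take (Suc k) (nf h)) = h'' \<otimes> ?u j'"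
        using cov[OF h] by blast
      have h'F: "h' \<in> carrier F" "h'' \<in> carrier F" "h' \<in> H"
        using h' h'' gen_sub by auto
      define m where "m = nf h ! k"
      have m: "m \<in> S \<times> UNIV"
        using Suc.prems nf_letters[OF hF] unfolding m_def by (metis Suc_le_lessD nth_mem subsetD)
      have "eval (take (Suc k) (nf h)) = eval (take k (nf h)) \<otimes> ev m"
        using Suc.prems m take_nf_letters[OF hF]
        by (simp add: take_Suc_conv_app_nth eval_append m_def)
      then have eq: "h'' \<otimes> ?u j' = h' \<otimes> (?u j \<otimes> ev m)"
        using h'' h' h'F u m by (simp add: m_assoc)
      \<comment> \<open>The jump between the two translating elements, written as a path through the
        edge \<open>m\<close>.\<close>
      have d: "inv h' \<otimes> h'' = ?u j \<otimes> ev m \<otimes> inv (?u j')"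
      proof -
        have "inv h' \<otimes> (h'' \<otimes> ?u j') \<otimes> inv (?u j') = ?u j \<otimes> ev m \<otimes> inv (?u j')"
          unfolding eq using h'F u m by (simp add: m_assoc[symmetric])
        then show ?thesis
          using h'F u by (simp add: m_assoc)
      qed
      have "len (?u j \<otimes> ev m \<otimes> inv (?u j')) \<le> len (?u j) + len (ev m) + len (inv (?u j'))"
        using len_mult_le[of "?u j \<otimes> ev m" "inv (?u j')"] len_mult_le[of "?u j" "ev m"] u m by simp
      also have "\<dots> \<le> 2 * len a + 1"
        using u[of j] u[of j'] m by (simp add: len_ev len_inv)
      finally have "len (inv h' \<otimes> h'') \<le> 2 * len a + 1"
        by (simp only: d)
      moreover have "inv h' \<otimes> h'' \<in> H" "inv h' \<otimes> h'' \<in> carrier F"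
        using h'F h'' by simp_all
      ultimately have "inv h' \<otimes> h'' \<in> ?B"
        by blast
      then have "h' \<otimes> (inv h' \<otimes> h'') \<in> generate F ?B"
        using h'(1) by (blast intro: generate.eng generate.incl)
      also have "h' \<otimes> (inv h' \<otimes> h'') = h''"
        using h'F by (simp add: m_assoc[symmetric])
      finally show ?case
        using h''(2) by blast
    qed
    from this[of "length (nf h)"] obtain h' j where
      h': "h' \<in> generate F ?B" "h = h' \<otimes> ?u j"
      using hF by (auto simp: eval_nf)
    then have h'H: "h' \<in> H" "h' \<in> carrier F"
      using gen_sub by auto
    \<comment> \<open>At the end of the walk the leftover piece of the segment lies in
      \<open>H\<close> itself and is short, so it is a generator too.\<close>
    then have "?u j = inv h' \<otimes> h"
      using h'(2) u by (simp add: m_assoc[symmetric])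
    then have "?u j \<in> H"
      using h'H h by simp
    then have "?u j \<in> ?B"
      using u[of j] by simp
    then show "h \<in> generate F ?B"
      using h' by (auto intro: generate.eng generate.incl)
  qed
qed

text \<open>Since \<open>\<psi> a = a\<close>, the points \<open>\<psi> g\<close> and
  \<open>\<psi> (g \<otimes> a)\<close> are joined by a translate of the segment from 1 to
  \<open>a\<close>. A vertex \<open>v\<close> off all these translates therefore never separates
  them, which makes the pulled-back half-tree invariant under right multiplication by
  \<open>a\<close>.\<close>

lemma fixed_element_almost_invariant:
  assumes "finite S" and \<phi>: "\<phi> \<in> mon F F" "\<phi> \<notin> iso F F" and a: "a \<in> carrier F" "\<phi> a = a"
  shows "\<exists>P \<subseteq> carrier F. P \<noteq> {} \<and> P \<noteq> carrier F \<and> almost_invariant P \<and>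
    (\<forall>g \<in> carrier F. g \<otimes> a \<in> P \<longleftrightarrow> g \<in> P)"
proof -
  let ?u = "\<lambda>j. eval (take j (nf a))"
  define H where "H = (\<lambda>n. (\<phi> ^^ n) ` carrier F)"
  have hom: "(\<phi> ^^ n) \<in> hom F F" for n
    using mon_funpow[OF \<phi>(1)] by (simp add: mon_def)
  have sub: "subgroup (H n) F" for n
    unfolding H_def using hom[of n]
    by (simp add: group_hom.img_is_subgroup group_hom.intro group_hom_axioms.intro)
  have u: "?u j \<in> carrier F" for j
    using a by (simp add: take_nf_letters)
  have fix_a: "(\<phi> ^^ n) a = a" for n
    using a(2) by (induction n) auto
  have "\<exists>n. \<exists>h \<in> H n. \<exists>k. \<forall>h' \<in> H n. \<forall>j. eval (take k (nf h)) \<noteq> h' \<otimes> ?u j"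
  proof (rule ccontr)
    assume "\<not> ?thesis"
    then have "\<exists>h' \<in> H n. \<exists>j. eval (take k (nf h)) = h' \<otimes> ?u j" if "h \<in> H n" for n h k
      using that by blast
    note gen = subgroup_generated_by_ball[OF sub a(1) this]
    let ?B = "{g \<in> carrier F. len g \<le> 2 * len a + 1}"
    have "finite (range (\<lambda>n. H n \<inter> ?B))"
      by (rule finite_subset[of _ "Pow ?B"]) (use finite_ball[OF assms(1)] in auto)
    then have "\<not> inj (\<lambda>n. H n \<inter> ?B)"
      using finite_imageD infinite_UNIV_nat by blast
    then obtain n m where "n \<noteq> m" "H n \<inter> ?B = H m \<inter> ?B"
      by (auto simp: inj_def)
    then have "n \<noteq> m" "H n = H m"
      using gen[of n] gen[of m] by auto
    then show False
      using mon_image_chain_collapse[OF \<phi>(1), of n m] mon_image_chain_collapse[OF \<phi>(1), of m n] \<phi>(2)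
      unfolding H_def by (metis linorder_neqE_nat)
  qed
  then obtain n h k where h: "h \<in> H n"
    and off: "\<And>h' j. h' \<in> H n \<Longrightarrow> eval (take k (nf h)) \<noteq> h' \<otimes> ?u j"
    by blast
  define \<psi> where "\<psi> = \<phi> ^^ n"
  define v where "v = eval (take k (nf h))"
  have \<psi>: "\<psi> \<in> mon F F" "\<psi> \<in> hom F F" "\<psi> a = a"
    using mon_funpow[OF \<phi>(1)] hom fix_a by (simp_all add: \<psi>_def)
  have \<psi>_cl: "\<psi> g \<in> carrier F" if "g \<in> carrier F" for g
    using \<psi>(2) that by (rule hom_in_carrier)
  interpret \<psi>: group_hom F F \<psi>
    using \<psi>(2) by unfold_locales
  have off: "v \<noteq> \<psi> g \<otimes> ?u j" if "g \<in> carrier F" for g j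
    using off[of "\<psi> g"] that by (simp add: v_def H_def \<psi>_def)
  obtain h0 where h0: "h0 \<in> carrier F" "\<psi> h0 = h"
    using h by (auto simp: H_def \<psi>_def)
  have hF: "h \<in> carrier F"
    using h0 \<psi>_cl by blast
  have vF: "v \<in> carrier F"
    using hF by (simp add: v_def take_nf_letters)
  \<comment> \<open>Taking the translating elements 1 and \<open>h\<close> with the empty prefix of
    \<open>a\<close> shows that \<open>v\<close> is an interior vertex of the path from 1 to
    \<open>h\<close>.\<close>
  have "v \<noteq> \<one>"
    using off[of \<one> 0] by simp
  have "v \<noteq> h"
    using off[OF h0(1), of 0] h0(2) hF by simp
  then have k: "k < length (nf h)"
    unfolding v_def using hF by (metis eval_nf not_le take_all)
  define l where "l = nf h ! k"
  have red: "take k (nf h) @ drop k (nf h) \<in> reduced_words S"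
    using nf_reduced[OF hF] by simp
  then have redt: "take k (nf h) \<in> reduced_words S" and redd: "drop k (nf h) \<in> reduced_words S"
    by (simp_all add: reduced_words_take reduced_words_drop nf_reduced[OF hF])
  have tne: "take k (nf h) \<noteq> []"
    using \<open>v \<noteq> \<one>\<close> by (metis eval_Nil v_def)
  have l: "hd (drop k (nf h)) = l"
    using k by (simp add: l_def hd_drop_conv_nth)
  have "l \<noteq> flip (last (take k (nf h)))"
  proof -
    have "drop k (nf h) \<noteq> []"
      using k by simp
    then show ?thesis
      using red tne l unfolding reduced_words_append by blast
  qed
  \<comment> \<open>The half-tree beyond the edge by which the path to \<open>h\<close> leaves
    \<open>v\<close>: 1 is on the near side, \<open>h\<close> on the far side.\<close>
  let ?P = "{g \<in> carrier F. inv v \<otimes> \<psi> g \<in> cone l}"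
  have "\<one> \<notin> ?P"
  proof -
    have "nf v = take k (nf h)"
      unfolding v_def by (rule nf_eval[OF redt])
    then have "hd (nf (inv v)) = flip (last (take k (nf h)))"
      using tne by (simp add: nf_inv[OF vF] hd_rev last_map)
    then show ?thesis
      using \<open>l \<noteq> _\<close> vF by (simp add: cone_def)
  qed
  moreover have "h0 \<in> ?P"
  proof -
    have "h = v \<otimes> eval (drop k (nf h))"
      unfolding v_def using hF redd
      by (metis append_take_drop_id eval_append eval_nf reduced_letters redt)
    then have "inv v \<otimes> h = eval (drop k (nf h))"
      using vF redd reduced_letters by (metis eval_closed inv_solve_left hF)
    then have "nf (inv v \<otimes> h) = drop k (nf h)"
      using nf_eval[OF redd] by simp
    then show ?thesis
      using h0 k l vF hF by (simp add: cone_def)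
  qed
  moreover have "g \<otimes> a \<in> ?P \<longleftrightarrow> g \<in> ?P" if g: "g \<in> carrier F" for g
  proof (rule ccontr)
    assume "\<not> ?thesis"
    then have "inv v \<otimes> \<psi> g \<in> cone l \<longleftrightarrow> inv v \<otimes> \<psi> g \<otimes> eval (nf a) \<notin> cone l"
      using g a vF \<psi>_cl by (auto simp: \<psi>(3) eval_nf m_assoc)
    then obtain j where "inv v \<otimes> \<psi> g \<otimes> ?u j = \<one>"
      using cone_crossing[of "nf a" "inv v \<otimes> \<psi> g" l] g a vF nf_letters[OF a(1)] \<psi>_cl by auto
    then have "inv v \<otimes> (\<psi> g \<otimes> ?u j) = \<one>"
      using g vF u \<psi>_cl by (simp add: m_assoc)
    then have "v = \<psi> g \<otimes> ?u j"
      using g vF u \<psi>_cl by (metis inv_solve_left m_closed one_closed r_one)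
    then show False
      using off[OF g] by simp
  qed
  moreover have "almost_invariant ?P"
    by (rule almost_invariant_pullback_cone[OF \<psi>(1) vF])
  ultimately show ?thesis
    using h0(1) by (intro exI[of _ ?P]) blast
qed

subsection \<open>Lines in the Cayley graph and almost invariant sets\<close>

text \<open>Labels are kept beside the vertices because turns are compared up to translation. The
  two directions of the line at \<open>p i\<close> are \<open>l i\<close> and
  \<open>flip (l (i - 1))\<close>, and these form the turn at \<open>p i\<close>.\<close>

definition labelled_line :: "(int \<Rightarrow> 'a) \<Rightarrow> (int \<Rightarrow> 'a \<times> bool) \<Rightarrow> bool" where
  "labelled_line p l \<longleftrightarrow>
     (\<forall>i. p i \<in> carrier F \<and> l i \<in> S \<times> UNIV \<and> p (i + 1) = p i \<otimes> ev (l i) \<and> l (i + 1) \<noteq> flip (l i))"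

lemma labelled_lineD:
  assumes "labelled_line p l"
  shows "p i \<in> carrier F" "l i \<in> S \<times> UNIV" "p (i + 1) = p i \<otimes> ev (l i)" "l (i + 1) \<noteq> flip (l i)"
  using assms by (auto simp: labelled_line_def simp del: mem_Sigma_iff)

lemma labelled_line_reverse:
  assumes "labelled_line p l"
  shows "labelled_line (\<lambda>i. p (- i)) (\<lambda>i. flip (l (- i - 1)))"
  unfolding labelled_line_def
proof (intro allI conjI)
  fix i
  note D = labelled_lineD[OF assms]
  have "p (- i) = p (- (i + 1)) \<otimes> ev (l (- i - 1))"
    using D(3)[of "- i - 1"] by simp
  then show "p (- (i + 1)) = p (- i) \<otimes> ev (flip (l (- i - 1)))"
    using D(1,2) by (simp add: ev_flip m_assoc)
  have "- i - 2 + 1 = - i - 1" "- (i + 1) - 1 = - i - 2"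
    by simp_all
  then show "flip (l (- (i + 1) - 1)) \<noteq> flip (flip (l (- i - 1)))"
    using D(4)[of "- i - 2"] by (metis flip_flip)
qed (simp_all add: labelled_lineD[OF assms] del: mem_Sigma_iff)

lemma labelled_line_shift:
  assumes "labelled_line p l"
  shows "labelled_line (\<lambda>i. p (i + c)) (\<lambda>i. l (i + c))"
proof -
  have "i + 1 + c = i + c + 1" for i
    by simp
  with assms show ?thesis
    unfolding labelled_line_def by metis
qed

definition labels :: "(int \<Rightarrow> 'a \<times> bool) \<Rightarrow> int \<Rightarrow> nat \<Rightarrow> ('a \<times> bool) list" where
  "labels l i n = map (\<lambda>j. l (i + int j)) [0..<n]"

lemma length_labels [simp]: "length (labels l i n) = n"
  by (simp add: labels_def)

lemma labels_Suc: "labels l i (Suc n) = labels l i n @ [l (i + int n)]"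
  by (simp add: labels_def)

lemma hd_labels: "0 < n \<Longrightarrow> hd (labels l i n) = l i"
  by (simp add: labels_def hd_map)

lemma last_labels: "0 < n \<Longrightarrow> last (labels l i n) = l (i + int n - 1)"
  by (simp add: labels_def last_map of_nat_diff algebra_simps)

lemma labels_reduced: "labelled_line p l \<Longrightarrow> labels l i n \<in> reduced_words S"
proof (induction n)
  case (Suc n)
  show ?case
  proof (cases "n = 0")
    case True
    then show ?thesis
      using labelled_lineD(2)[OF Suc.prems] by (simp add: labels_def reduced_words_Cons del: mem_Sigma_iff)
  next
    case False
    then have "labels l i n \<noteq> []"
      by (simp add: labels_def)
    then show ?thesis
      using Suc False labelled_lineD(2)[OF Suc.prems] labelled_lineD(4)[OF Suc.prems, of "i + int n - 1"]
      by (simp add: labels_Suc reduced_words_append reduced_words_Cons last_labels del: mem_Sigma_iff)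
  qed
qed (simp add: labels_def)

lemma labelled_line_path:
  assumes "labelled_line p l"
  shows "p (i + int n) = p i \<otimes> eval (labels l i n)"
proof (induction n)
  case 0
  then show ?case
    using labelled_lineD(1)[OF assms] by (simp add: labels_def)
next
  case (Suc n)
  have "p (i + int (Suc n)) = p (i + int n) \<otimes> ev (l (i + int n))"
    using labelled_lineD(3)[OF assms, of "i + int n"] by (simp add: algebra_simps)
  then show ?case
    using Suc labelled_lineD(1,2)[OF assms] reduced_letters[OF labels_reduced[OF assms]]
    by (simp add: labels_Suc eval_append m_assoc del: mem_Sigma_iff)
qed

lemma labelled_line_diff:
  assumes "labelled_line p l"
  shows "inv (p i) \<otimes> p (i + int n) = eval (labels l i n)"
  using labelled_lineD(1)[OF assms] reduced_letters[OF labels_reduced[OF assms]]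
  by (simp add: labelled_line_path[OF assms] m_assoc[symmetric])

lemma len_inv_mult_commute:
  assumes "x \<in> carrier F" "y \<in> carrier F"
  shows "len (inv x \<otimes> y) = len (inv y \<otimes> x)"
  using len_inv[of "inv x \<otimes> y"] assms by (simp add: inv_mult_group)

lemma labelled_line_dist:
  assumes "labelled_line p l"
  shows "len (inv (p i) \<otimes> p j) = nat \<bar>i - j\<bar>"
proof -
  have *: "len (inv (p i) \<otimes> p j) = nat (j - i)" if "i \<le> j" for i j
    using labelled_line_diff[OF assms, of i "nat (j - i)"] that
    by (simp add: len_eval labels_reduced[OF assms])
  show ?thesis
  proof (cases "i \<le> j")
    case False
    then show ?thesis
      using *[of j i] len_inv_mult_commute labelled_lineD(1)[OF assms] by simp
  qed (simp add: *)
qed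

lemma labelled_line_inj:
  assumes "labelled_line p l" "p i = p j"
  shows "i = j"
  using labelled_line_dist[OF assms(1), of i j] assms(2) labelled_lineD(1)[OF assms(1)]
  by (simp add: len_nf)

text \<open>The parametrization is oriented so that \<open>a\<close> moves forward; the same line
  run backwards serves \<open>inv a\<close>.\<close>

definition axis_line :: "'a \<Rightarrow> (int \<Rightarrow> 'a) \<Rightarrow> (int \<Rightarrow> 'a \<times> bool) \<Rightarrow> int \<Rightarrow> bool" where
  "axis_line a p l k \<longleftrightarrow> labelled_line p l \<and> 0 < k \<and> (\<forall>i. a \<otimes> p i = p (i + k))"

lemma axis_line_reverse:
  assumes "a \<in> carrier F" "axis_line a p l k"
  shows "axis_line (inv a) (\<lambda>i. p (- i)) (\<lambda>i. flip (l (- i - 1))) k"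
proof -
  have "inv a \<otimes> p (- i) = p (- (i + k))" for i
  proof -
    have "a \<otimes> p (- i - k) = p (- i)" "p (- i - k) \<in> carrier F"
      using assms(2) labelled_lineD(1)[of p l] by (simp_all add: axis_line_def)
    then show ?thesis
      using assms(1) by (metis inv_solve_left m_closed minus_add_distrib diff_conv_add_uminus)
  qed
  then show ?thesis
    using assms by (simp add: axis_line_def labelled_line_reverse)
qed

lemma axis_line_pow:
  assumes "a \<in> carrier F" "axis_line a p l k"
  shows "a [^] n \<otimes> p i = p (i + int n * k)"
proof (induction n arbitrary: i)
  case 0
  then show ?case
    using assms(2) labelled_lineD(1)[of p l] by (simp add: axis_line_def)
next
  case (Suc n)
  have pi: "p i \<in> carrier F"
    using assms(2) labelled_lineD(1)[of p l] by (simp add: axis_line_def)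
  have "a [^] Suc n \<otimes> p i = a [^] n \<otimes> p (i + k)"
    using assms pi by (simp add: m_assoc axis_line_def)
  then show ?case
    using Suc by (simp add: algebra_simps)
qed

section \<open>Subtrees seen from the identity, and the vertices below which both colours
  persist\<close>

definition shadow :: "'a \<Rightarrow> 'a set" where
  "shadow v = {x \<in> carrier F. \<exists>ws. nf x = nf v @ ws}"

text \<open>A finite-level substitute for saying that ends of both colours lie below
  \<open>v\<close>.\<close>

definition split_by :: "'a set \<Rightarrow> 'a \<Rightarrow> bool" where
  "split_by P v \<longleftrightarrow> infinite (shadow v \<inter> P) \<and> infinite (shadow v - P)"

text \<open>The points \<open>g \<otimes> a^n \<otimes> p j\<close> with \<open>n > 0\<close> run
  along one ray, which \<open>dir\<close> forces away from 1. Up to finitely many exceptions they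
  have the colour of \<open>g \<otimes> a^n\<close>, and this is the colour of
  \<open>g\<close>.\<close>

lemma axis_line_shadow:
  assumes a: "a \<in> carrier F" and line: "axis_line a p l k"
    and P: "almost_invariant P" "\<And>g. g \<in> carrier F \<Longrightarrow> g \<otimes> a \<in> P \<longleftrightarrow> g \<in> P"
    and g: "g \<in> carrier F" and dir: "nf (g \<otimes> p j) \<noteq> [] \<Longrightarrow> l j \<noteq> flip (last (nf (g \<otimes> p j)))"
  shows "infinite {x \<in> shadow (g \<otimes> p j \<otimes> ev (l j)). x \<in> P \<longleftrightarrow> g \<in> P}"
proof -
  have ll: "labelled_line p l" and k: "0 < k"
    using line by (auto simp: axis_line_def)
  note D = labelled_lineD[OF ll]
  define h where "h = (\<lambda>n :: nat. g \<otimes> a [^] n)"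
  define x where "x = (\<lambda>n :: nat. g \<otimes> p (j + int n * k))"
  have h_cl: "h n \<in> carrier F" for n
    using g a by (simp add: h_def)
  have xh: "x n = h n \<otimes> p j" for n
    using axis_line_pow[OF a line, of n j] g a D(1) by (simp add: h_def x_def m_assoc)
  have x_inj: "inj x"
  proof (rule injI)
    fix n m assume "x n = x m"
    then have "p (j + int n * k) = p (j + int m * k)"
      using g D(1) by (simp add: x_def)
    then show "n = m"
      using labelled_line_inj[OF ll] k by fastforce
  qed
  then have h_inj: "inj h"
    by (metis injI inj_eq xh)
  have hP: "h n \<in> P \<longleftrightarrow> g \<in> P" for n
  proof (induction n)
    case (Suc n)
    have "h (Suc n) = h n \<otimes> a"
      using g a by (simp add: h_def m_assoc)
    then show ?case
      using P(2)[OF h_cl[of n]] Suc by simp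
  qed (use g in \<open>simp add: h_def\<close>)
  let ?B = "{h \<in> carrier F. h \<in> P \<longleftrightarrow> h \<otimes> p j \<notin> P}"
  have "finite ?B"
    using P(1) D(1) by (simp add: almost_invariant_def)
  then have "finite (h -` ?B)"
    using h_inj by (rule finite_vimageI)
  then have "finite (insert 0 (h -` ?B))"
    by simp
  \<comment> \<open>The index 0 is dropped because \<open>x 0\<close> is the start
    \<open>g \<otimes> p j\<close> of the ray, not a point below its child.\<close>
  define G where "G = - insert 0 (h -` ?B)"
  have "infinite G"
    unfolding G_def using \<open>finite (insert 0 (h -` ?B))\<close> by (metis finite_compl infinite_UNIV_nat)
  moreover have "inj_on x G"
    using x_inj by (rule inj_on_subset) simp
  ultimately have "infinite (x ` G)"
    using finite_imageD by blast
  moreover have "x ` G \<subseteq> {x \<in> shadow (g \<otimes> p j \<otimes> ev (l j)). x \<in> P \<longleftrightarrow> g \<in> P}"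
  proof
    fix y assume "y \<in> x ` G"
    then obtain n where n: "y = x n" "0 < n" "h n \<notin> ?B"
      by (auto simp: G_def)
    have "y \<in> P \<longleftrightarrow> g \<in> P"
      using n(1,3) h_cl[of n] hP[of n] by (simp add: xh)
    moreover have "y \<in> shadow (g \<otimes> p j \<otimes> ev (l j))"
    proof -
      define v where "v = g \<otimes> p j"
      define N where "N = nat (int n * k)"
      have "0 < int n * k"
        using n(2) k by simp
      then have N: "0 < N" "int N = int n * k"
        by (simp_all add: N_def)
      have v: "v \<in> carrier F"
        using g D(1) by (simp add: v_def)
      have red: "labels l j N \<in> reduced_words S"
        by (rule labels_reduced[OF ll])
      have y: "y = v \<otimes> eval (labels l j N)"
        using labelled_line_path[OF ll, of j N] N g D(1) reduced_letters[OF red]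
        by (simp add: n(1) x_def v_def m_assoc)
      have "nf v @ labels l j N \<in> reduced_words S"
        using nf_reduced[OF v] red dir hd_labels[OF N(1), of l j]
        by (simp add: reduced_words_append v_def)
      then have "nf y = nf v @ labels l j N"
        using nf_mult[of v "eval (labels l j N)"] v red by (simp add: y nf_eval reduced_letters)
      moreover have "labels l j N = l j # tl (labels l j N)"
        using hd_labels[OF N(1), of l j] N(1) by (metis hd_Cons_tl length_labels list.size(3) less_irrefl)
      moreover have "nf (v \<otimes> ev (l j)) = nf v @ [l j]"
        using nf_mult_ev[OF D(2) v, of j] dir by (auto simp: v_def[symmetric] flip_eq_iff)
      ultimately have "nf y = nf (v \<otimes> ev (l j)) @ tl (labels l j N)"
        by (metis append.assoc append_Cons append_Nil)
      moreover have "y \<in> carrier F"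
        using v red by (simp add: y reduced_letters)
      ultimately show ?thesis
        by (auto simp: shadow_def v_def)
    qed
    ultimately show "y \<in> {x \<in> shadow (g \<otimes> p j \<otimes> ev (l j)). x \<in> P \<longleftrightarrow> g \<in> P}"
      by simp
  qed
  ultimately show ?thesis
    using finite_subset by blast
qed

lemma shadow_one: "shadow \<one> = carrier F"
  by (simp add: shadow_def)

lemma shadow_children:
  assumes v: "v \<in> carrier F"
  shows "shadow v \<subseteq> insert v (\<Union>m \<in> {m \<in> S \<times> UNIV. nf v \<noteq> [] \<longrightarrow> m \<noteq> flip (last (nf v))}.
    shadow (v \<otimes> ev m))"
proof
  fix x assume "x \<in> shadow v"
  then obtain ws where x: "x \<in> carrier F" "nf x = nf v @ ws"
    by (auto simp: shadow_def)
  show "x \<in> insert v (\<Union>m \<in> {m \<in> S \<times> UNIV. nf v \<noteq> [] \<longrightarrow> m \<noteq> flip (last (nf v))}. shadow (v \<otimes> ev m))"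
  proof (cases ws)
    case Nil
    then show ?thesis
      using x v nf_inj by simp
  next
    case (Cons m ws')
    have red: "nf v @ m # ws' \<in> reduced_words S"
      using nf_reduced[OF x(1)] x(2) Cons by simp
    then have m: "m \<in> S \<times> UNIV" "nf v \<noteq> [] \<longrightarrow> m \<noteq> flip (last (nf v))"
      by (auto simp: reduced_words_append reduced_words_Cons)
    have "nf (v \<otimes> ev m) = nf v @ [m]"
      using nf_mult_ev[OF m(1) v] m(2) by (auto simp: flip_eq_iff)
    then have "x \<in> shadow (v \<otimes> ev m)"
      using x Cons by (simp add: shadow_def)
    then show ?thesis
      using m by blast
  qed
qed

text \<open>Only finitely many vertices are incident with an edge joining \<open>P\<close> to its
  complement. Below a vertex farther out than all of them, the colour is constant.\<close>

lemma shadow_split_bounded: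
  assumes S: "finite S" and P: "almost_invariant P"
  shows "\<exists>N. \<forall>v \<in> carrier F. split_by P v \<longrightarrow> len v < N"
proof -
  let ?D = "\<Union>m \<in> S \<times> UNIV. {g \<in> carrier F. g \<in> P \<longleftrightarrow> g \<otimes> ev m \<notin> P}"
  have "finite ?D"
    using S P by (intro finite_UN_I) (auto simp: almost_invariant_def simp del: mem_Sigma_iff)
  then have "finite (len ` ?D)"
    by simp
  then obtain N where N: "\<And>g. g \<in> ?D \<Longrightarrow> len g < N"
    by (meson finite_nat_set_iff_bounded imageI)
  have "\<not> split_by P v" if v: "v \<in> carrier F" "N \<le> len v" for v
  proof -
    have *: "x \<in> P \<longleftrightarrow> v \<in> P" if "x \<in> carrier F" "nf x = nf v @ ws" for x ws
      using that
    proof (induction ws arbitrary: x rule: rev_induct)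
      case Nil
      then show ?case
        using v(1) nf_inj by (metis append_Nil2)
    next
      case (snoc m ws)
      define y where "y = eval (nf v @ ws)"
      have red: "nf v @ ws @ [m] \<in> reduced_words S"
        using snoc.prems nf_reduced by metis
      then have red': "nf v @ ws \<in> reduced_words S" and m: "m \<in> S \<times> UNIV"
        by (metis append_assoc reduced_words_append)
          (use red in \<open>auto simp: reduced_words_append reduced_words_Cons\<close>)
      have y: "y \<in> carrier F" "nf y = nf v @ ws"
        using red' by (simp_all add: y_def nf_eval reduced_letters del: set_append)
      have "x = eval ((nf v @ ws) @ [m])"
        using snoc.prems eval_nf[of x] by simp
      also have "\<dots> = y \<otimes> ev m"
        using eval_append[OF reduced_letters[OF red'], of "[m]"] m by (simp add: y_def)
      finally have "x = y \<otimes> ev m" .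
      moreover have "y \<notin> ?D"
        using N[of y] y(2) v(2) by (auto simp: len_nf)
      ultimately have "x \<in> P \<longleftrightarrow> y \<in> P"
        using y(1) m by blast
      then show ?case
        using snoc.IH[OF y] by simp
    qed
    then have "shadow v \<inter> P = {} \<or> shadow v - P = {}"
      by (auto simp: shadow_def)
    then show ?thesis
      unfolding split_by_def by (metis finite.emptyI)
  qed
  then show ?thesis
    by (meson not_le)
qed

text \<open>At a split vertex \<open>v\<close> of maximal length, each direction away from 1 has
  essentially one colour and both colours occur. A translate of the axis through \<open>v\<close>
  has both its rays coloured like one and the same \<open>g\<close>, so it never turns from one
  colour class to the other.\<close>

lemma almost_invariant_contradiction:
  assumes S: "finite S" "s \<in> S" "t \<in> S" "s \<noteq> t"
    and a: "a \<in> carrier F" and line: "axis_line a p l k"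
    and P: "P \<subseteq> carrier F" "P \<noteq> {}" "P \<noteq> carrier F" "almost_invariant P"
      "\<And>g. g \<in> carrier F \<Longrightarrow> g \<otimes> a \<in> P \<longleftrightarrow> g \<in> P"
    and conn: "\<And>x A B. x \<in> S \<times> UNIV \<Longrightarrow> A \<union> B = S \<times> UNIV - {x} \<Longrightarrow> A \<inter> B = {} \<Longrightarrow>
      A \<noteq> {} \<Longrightarrow> B \<noteq> {} \<Longrightarrow>
      \<exists>i. flip (l (i - 1)) \<in> A \<and> l i \<in> B \<or> flip (l (i - 1)) \<in> B \<and> l i \<in> A"
  shows False
proof -
  have ll: "labelled_line p l"
    using line by (simp add: axis_line_def)
  note D = labelled_lineD[OF ll]
  have P': "g \<otimes> inv a \<in> P \<longleftrightarrow> g \<in> P" if "g \<in> carrier F" for g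
    using P(5)[of "g \<otimes> inv a"] that a by (simp add: m_assoc)
  have inf: "infinite {x \<in> carrier F. x \<in> P \<longleftrightarrow> g \<in> P}" if g: "g \<in> carrier F" for g
  proof -
    define q where "q = (\<lambda>n :: nat. g \<otimes> a [^] n)"
    have "inj q"
    proof (rule injI)
      fix n m assume "q n = q m"
      then have "a [^] n = a [^] m"
        using g a by (simp add: q_def)
      then have "p (int n * k) = p (int m * k)"
        using axis_line_pow[OF a line, of n 0] axis_line_pow[OF a line, of m 0] by simp
      then show "n = m"
        using labelled_line_inj[OF ll] line by (fastforce simp: axis_line_def)
    qed
    moreover have "q n \<in> P \<longleftrightarrow> g \<in> P" for n
    proof (induction n)
      case (Suc n)
      have "q (Suc n) = q n \<otimes> a"
        using g a by (simp add: q_def m_assoc)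
      then show ?case
        using P(5)[of "q n"] Suc g a by (simp add: q_def)
    qed (use g in \<open>simp add: q_def\<close>)
    then have "range q \<subseteq> {x \<in> carrier F. x \<in> P \<longleftrightarrow> g \<in> P}"
      using g a by (auto simp: q_def)
    ultimately show ?thesis
      using infinite_super range_inj_infinite by blast
  qed
  \<comment> \<open>The orbits of an element of \<open>P\<close> and of an element outside
    \<open>P\<close> under right multiplication by powers of \<open>a\<close> are infinite and keep
    their colour.\<close>
  have "split_by P \<one>"
  proof -
    obtain g h where gh: "g \<in> P" "h \<in> carrier F" "h \<notin> P"
      using P(1-3) by blast
    have "{x \<in> carrier F. x \<in> P \<longleftrightarrow> g \<in> P} = carrier F \<inter> P"
      "{x \<in> carrier F. x \<in> P \<longleftrightarrow> h \<in> P} = carrier F - P"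
      using gh by auto
    then show ?thesis
      using inf[of g] inf[of h] gh P(1) by (auto simp: split_by_def shadow_one)
  qed
  moreover obtain N where "\<And>v. v \<in> carrier F \<Longrightarrow> split_by P v \<Longrightarrow> len v < N"
    using shadow_split_bounded[OF S(1) P(4)] by blast
  ultimately obtain v where v: "v \<in> carrier F" "split_by P v"
    and max: "\<And>u. u \<in> carrier F \<Longrightarrow> split_by P u \<Longrightarrow> len u \<le> len v"
    using ex_has_greatest_nat[of "\<lambda>v. v \<in> carrier F \<and> split_by P v" \<one> len N]
    by (metis less_imp_le one_closed)
  define M where "M = {m \<in> S \<times> UNIV. nf v \<noteq> [] \<longrightarrow> m \<noteq> flip (last (nf v))}"
  have "finite M"
    using S(1) by (simp add: M_def del: mem_Sigma_iff)
  define A where "A = {m \<in> M. infinite (shadow (v \<otimes> ev m) \<inter> P)}"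
  define B where "B = M - A"
  have child: "finite (shadow (v \<otimes> ev m) \<inter> P) \<or> finite (shadow (v \<otimes> ev m) - P)" if "m \<in> M" for m
  proof -
    have m: "m \<in> S \<times> UNIV"
      using that by (simp add: M_def)
    have "nf (v \<otimes> ev m) = nf v @ [m]"
      using nf_mult_ev[OF m v(1)] that by (auto simp: M_def flip_eq_iff)
    then have "len (v \<otimes> ev m) > len v"
      by (simp add: len_nf)
    then have "\<not> split_by P (v \<otimes> ev m)"
      using max[of "v \<otimes> ev m"] m v(1) by force
    then show ?thesis
      by (simp add: split_by_def)
  qed
  \<comment> \<open>Finiteness of \<open>S\<close> is essential: an infinite set below
    \<open>v\<close> must be infinite below one of finitely many children.\<close>
  have ne: "\<exists>m \<in> M. infinite (shadow (v \<otimes> ev m) \<inter> Q)" if "infinite (shadow v \<inter> Q)" for Q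
  proof (rule ccontr)
    assume "\<not> ?thesis"
    then have "finite (insert v (\<Union>m \<in> M. shadow (v \<otimes> ev m) \<inter> Q))"
      using \<open>finite M\<close> by (intro finite.insertI finite_UN_I) auto
    moreover have "shadow v \<inter> Q \<subseteq> insert v (\<Union>m \<in> M. shadow (v \<otimes> ev m) \<inter> Q)"
      using shadow_children[OF v(1)] by (auto simp: M_def)
    ultimately show False
      using that finite_subset by blast
  qed
  have "A \<noteq> {}"
    using ne[of P] v(2) by (auto simp: A_def split_by_def)
  have "B \<noteq> {}"
    using ne[of "- P"] v(2) child by (auto simp: A_def B_def split_by_def Diff_eq)
  have turn: "\<not> (flip (l (i - 1)) \<in> A \<and> l i \<in> B \<or> flip (l (i - 1)) \<in> B \<and> l i \<in> A)" for i
  proof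
    assume sep: "flip (l (i - 1)) \<in> A \<and> l i \<in> B \<or> flip (l (i - 1)) \<in> B \<and> l i \<in> A"
    then have M: "l i \<in> M" "flip (l (i - 1)) \<in> M"
      by (auto simp: A_def B_def)
    \<comment> \<open>The translate that brings the vertex \<open>p i\<close> of the axis to
      \<open>v\<close>; the backward ray is handled as the forward ray of the reversed line.\<close>
    define g where "g = v \<otimes> inv (p i)"
    have g: "g \<in> carrier F" "g \<otimes> p i = v"
      using v(1) D(1) by (simp_all add: g_def m_assoc)
    have "infinite {x \<in> shadow (v \<otimes> ev (l i)). x \<in> P \<longleftrightarrow> g \<in> P}"
      using axis_line_shadow[OF a line P(4,5) g(1), of i] M(1) by (simp add: g(2) M_def)
    moreover have "infinite {x \<in> shadow (v \<otimes> ev (flip (l (i - 1)))). x \<in> P \<longleftrightarrow> g \<in> P}"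
      using axis_line_shadow[OF inv_closed[OF a] axis_line_reverse[OF a line] P(4) P' g(1), of "- i"] M(2)
      by (simp add: g(2) M_def)
    moreover have "{x \<in> X. x \<in> P \<longleftrightarrow> g \<in> P} = (if g \<in> P then X \<inter> P else X - P)" for X
      by auto
    ultimately have "l i \<in> A \<longleftrightarrow> g \<in> P" "flip (l (i - 1)) \<in> A \<longleftrightarrow> g \<in> P"
      using M child[OF M(1)] child[OF M(2)] by (auto simp: A_def split: if_splits)
    then show False
      using sep by (auto simp: B_def)
  qed
  have AB: "A \<union> B = M" "A \<inter> B = {}"
    by (auto simp: A_def B_def)
  \<comment> \<open>For \<open>v\<close> different from 1, the cut vertex is the direction back to
    1. At \<open>v = 1\<close> all directions are coloured, and a letter must be deleted that
    exhausts neither class.\<close>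
  have "\<exists>x \<in> S \<times> UNIV. M - {x} = S \<times> UNIV - {x} \<and> A - {x} \<noteq> {} \<and> B - {x} \<noteq> {}"
  proof (cases "nf v = []")
    case True
    then have M: "M = S \<times> UNIV"
      by (simp add: M_def)
    have "\<exists>x \<in> M. A - {x} \<noteq> {} \<and> B - {x} \<noteq> {}"
    proof (rule ccontr)
      assume "\<not> ?thesis"
      then have *: "A \<subseteq> {x} \<or> B \<subseteq> {x}" if "x \<in> M" for x
        using that by blast
      obtain y z where yz: "y \<in> A" "z \<in> B"
        using \<open>A \<noteq> {}\<close> \<open>B \<noteq> {}\<close> by blast
      then have "y \<noteq> z" "y \<in> M" "z \<in> M"
        using AB by blast+
      then have "B \<subseteq> {z}" "A \<subseteq> {y}" if "\<exists>u \<in> M. u \<noteq> y \<and> u \<noteq> z"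
        using that * yz AB by blast+
      \<comment> \<open>If no deletion works, the letters \<open>y\<close> and \<open>z\<close>
        alone make up the two classes. Two distinct generators supply a third letter.\<close>
      moreover have "\<exists>u \<in> {(s, True), (s, False), (t, True)}. u \<noteq> y \<and> u \<noteq> z"
        using S(4) by (cases y; cases z) auto
      then have "\<exists>u \<in> M. u \<noteq> y \<and> u \<noteq> z"
        using S(2,3) M by auto
      ultimately show False
        using AB by blast
    qed
    then show ?thesis
      using M by auto
  next
    case False
    then have "last (nf v) \<in> S \<times> UNIV"
      using nf_letters[OF v(1)] last_in_set by blast
    then have x: "flip (last (nf v)) \<in> S \<times> UNIV"
      by simp
    moreover have M: "M = S \<times> UNIV - {flip (last (nf v))}"
      using False by (auto simp: M_def)
    moreover have "A - {flip (last (nf v))} = A" "B - {flip (last (nf v))} = B"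
      using AB M by blast+
    ultimately show ?thesis
      using \<open>A \<noteq> {}\<close> \<open>B \<noteq> {}\<close> by (metis Diff_idemp)
  qed
  then obtain x where x: "x \<in> S \<times> UNIV" "M - {x} = S \<times> UNIV - {x}" "A - {x} \<noteq> {}" "B - {x} \<noteq> {}"
    by blast
  have "(A - {x}) \<union> (B - {x}) = S \<times> UNIV - {x}" "(A - {x}) \<inter> (B - {x}) = {}"
    using AB x(2) by blast+
  from conn[OF x(1) this x(3,4)] turn show False
    by blast
qed

end

subsection \<open>Axes\<close>

lemma int_isometry:
  fixes \<tau> :: "int \<Rightarrow> int"
  assumes "\<And>i j. \<bar>\<tau> i - \<tau> j\<bar> = \<bar>i - j\<bar>"
  shows "(\<forall>i. \<tau> i = \<tau> 0 + i) \<or> (\<forall>i. \<tau> i = \<tau> 0 - i)"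
proof -
  have "\<tau> 1 = \<tau> 0 + 1 \<or> \<tau> 1 = \<tau> 0 - 1"
    using assms[of 1 0] by linarith
  then show ?thesis
  proof
    assume "\<tau> 1 = \<tau> 0 + 1"
    then have "\<tau> i = \<tau> 0 + i" for i
      using assms[of i 0] assms[of i 1] by linarith
    then show ?thesis by blast
  next
    assume "\<tau> 1 = \<tau> 0 - 1"
    then have "\<tau> i = \<tau> 0 - i" for i
      using assms[of i 0] assms[of i 1] by linarith
    then show ?thesis by blast
  qed
qed

context based_free_group
begin

section \<open>Edges, distances and geodesics of the Cayley graph in terms of words\<close>

lemma cayley_edge_iff:
  "{x, y} \<in> cayley_edges F S \<longleftrightarrow> x \<in> carrier F \<and> (\<exists>m \<in> S \<times> UNIV. y = x \<otimes> ev m)"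
proof
  assume "{x, y} \<in> cayley_edges F S"
  then obtain g s where gs: "{x, y} = {g, g \<otimes> s}" "g \<in> carrier F" "s \<in> S"
    by (auto simp: cayley_edges_def)
  then have s: "s \<in> carrier F"
    using S_closed by blast
  consider "x = g" "y = g \<otimes> s" | "x = g \<otimes> s" "y = g"
    using gs(1) by (metis doubleton_eq_iff)
  then show "x \<in> carrier F \<and> (\<exists>m \<in> S \<times> UNIV. y = x \<otimes> ev m)"
  proof cases
    case 1
    then show ?thesis
      using gs by (auto simp: ev_def intro!: bexI[of _ "(s, True)"])
  next
    case 2
    then have "x \<in> carrier F" "y = x \<otimes> ev (s, False)"
      using gs s by (simp_all add: ev_def m_assoc)
    then show ?thesis
      using gs(3) by blast
  qed
next
  assume "x \<in> carrier F \<and> (\<exists>m \<in> S \<times> UNIV. y = x \<otimes> ev m)"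
  then obtain s b where xs: "x \<in> carrier F" "s \<in> S" "y = x \<otimes> ev (s, b)"
    by auto
  then have s: "s \<in> carrier F"
    using S_closed by blast
  show "{x, y} \<in> cayley_edges F S"
  proof (cases b)
    case True
    then show ?thesis
      using xs by (auto simp: cayley_edges_def ev_def)
  next
    case False
    then have "x = y \<otimes> s" "y \<in> carrier F"
      using xs s by (simp_all add: ev_def m_assoc)
    then have "{x, y} = {y, y \<otimes> s}"
      by blast
    then show ?thesis
      using \<open>y \<in> carrier F\<close> xs(2) by (auto simp: cayley_edges_def)
  qed
qed

lemma cayley_path_iff:
  assumes "x \<in> carrier F"
  shows "(x, y) \<in> {(x, y). {x, y} \<in> cayley_edges F S} ^^ n \<longleftrightarrow>
    (\<exists>ws. set ws \<subseteq> S \<times> UNIV \<and> length ws = n \<and> y = x \<otimes> eval ws)"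
proof (induction n arbitrary: y)
  case 0
  then show ?case
    using assms by auto
next
  case (Suc n)
  show ?case
  proof
    assume "(x, y) \<in> {(x, y). {x, y} \<in> cayley_edges F S} ^^ Suc n"
    then obtain z where z: "(x, z) \<in> {(x, y). {x, y} \<in> cayley_edges F S} ^^ n"
        "{z, y} \<in> cayley_edges F S"
      by auto
    obtain ws where ws: "set ws \<subseteq> S \<times> UNIV" "length ws = n" "z = x \<otimes> eval ws"
      using z(1) unfolding Suc by blast
    obtain m where m: "m \<in> S \<times> UNIV" "y = z \<otimes> ev m"
      using z(2) unfolding cayley_edge_iff by blast
    with ws have "y = x \<otimes> eval (ws @ [m])"
      using assms by (simp add: eval_append m_assoc)
    then show "\<exists>ws. set ws \<subseteq> S \<times> UNIV \<and> length ws = Suc n \<and> y = x \<otimes> eval ws"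
      using ws m by (intro exI[of _ "ws @ [m]"]) simp
  next
    assume "\<exists>ws. set ws \<subseteq> S \<times> UNIV \<and> length ws = Suc n \<and> y = x \<otimes> eval ws"
    then obtain ws where ws: "set ws \<subseteq> S \<times> UNIV" "length ws = Suc n" "y = x \<otimes> eval ws"
      by blast
    then obtain vs m where vs: "ws = vs @ [m]"
      by (metis length_0_conv nat.simps(3) rev_exhaust)
    define z where "z = x \<otimes> eval vs"
    have "set vs \<subseteq> S \<times> UNIV" "m \<in> S \<times> UNIV"
      using ws vs by auto
    then have "z \<in> carrier F" "y = z \<otimes> ev m"
      using ws vs assms by (simp_all add: z_def eval_append m_assoc)
    then have "{z, y} \<in> cayley_edges F S"
      using \<open>m \<in> S \<times> UNIV\<close> cayley_edge_iff by blast
    moreover have "(x, z) \<in> {(x, y). {x, y} \<in> cayley_edges F S} ^^ n"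
      using \<open>set vs \<subseteq> S \<times> UNIV\<close> ws(2) vs by (auto simp: Suc z_def)
    ultimately show "(x, y) \<in> {(x, y). {x, y} \<in> cayley_edges F S} ^^ Suc n"
      by auto
  qed
qed

lemma cayley_dist_eq:
  assumes "x \<in> carrier F" "y \<in> carrier F"
  shows "cayley_dist F S x y = len (inv x \<otimes> y)"
  unfolding cayley_dist_def
proof (rule Least_equality)
  have "y = x \<otimes> eval (nf (inv x \<otimes> y))"
    using assms by (simp add: eval_nf m_assoc[symmetric])
  moreover have "set (nf (inv x \<otimes> y)) \<subseteq> S \<times> UNIV"
    using assms by (simp add: nf_letters)
  ultimately show "(x, y) \<in> {(x, y). {x, y} \<in> cayley_edges F S} ^^ len (inv x \<otimes> y)"
    unfolding cayley_path_iff[OF assms(1)] len_nf by blast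
next
  fix n assume "(x, y) \<in> {(x, y). {x, y} \<in> cayley_edges F S} ^^ n"
  then obtain ws where ws: "set ws \<subseteq> S \<times> UNIV" "length ws = n" "y = x \<otimes> eval ws"
    unfolding cayley_path_iff[OF assms(1)] by blast
  then have "inv x \<otimes> y = eval ws"
    using assms by (simp add: m_assoc[symmetric])
  then show "len (inv x \<otimes> y) \<le> n"
    using len_eval_le ws by metis
qed

definition edge :: "(int \<Rightarrow> 'a) \<Rightarrow> int \<Rightarrow> 'a set" where
  "edge p i = {p i, p (i + 1)}"

lemma geodesic_line_iff:
  "geodesic_line F S L \<longleftrightarrow> (\<exists>p l. labelled_line p l \<and> L = range (edge p))"
proof
  assume "geodesic_line F S L"
  then obtain p where p: "range p \<subseteq> carrier F" "\<And>i. {p i, p (i + 1)} \<in> cayley_edges F S"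
      "\<And>i j. cayley_dist F S (p i) (p j) = nat \<bar>i - j\<bar>" "L = range (edge p)"
    unfolding geodesic_line_def edge_def by blast
  have "\<exists>l. \<forall>i. l i \<in> S \<times> UNIV \<and> p (i + 1) = p i \<otimes> ev (l i)"
    using p(2) unfolding cayley_edge_iff by (intro choice) blast
  then obtain l where l: "\<And>i. l i \<in> S \<times> UNIV" "\<And>i. p (i + 1) = p i \<otimes> ev (l i)"
    by blast
  have cl: "p i \<in> carrier F" for i
    using p(1) by blast
  have "l (i + 1) \<noteq> flip (l i)" for i
  proof
    assume "l (i + 1) = flip (l i)"
    then have "p (i + 1 + 1) = p i"
      unfolding l(2)[of "i + 1"] l(2)[of i] using cl l(1)[of i] by (simp add: ev_flip m_assoc)
    then show False
      using p(3)[of "i + 1 + 1" i] cl by (simp add: cayley_dist_eq len_nf)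
  qed
  then have "labelled_line p l"
    using cl l unfolding labelled_line_def by blast
  then show "\<exists>p l. labelled_line p l \<and> L = range (edge p)"
    using p(4) by blast
next
  assume "\<exists>p l. labelled_line p l \<and> L = range (edge p)"
  then obtain p l where pl: "labelled_line p l" "L = range (edge p)"
    by blast
  note D = labelled_lineD[OF pl(1)]
  have "range p \<subseteq> carrier F"
    using D(1) by blast
  moreover have "\<forall>i. {p i, p (i + 1)} \<in> cayley_edges F S"
    unfolding cayley_edge_iff using D(1-3) by blast
  moreover have "\<forall>i j. cayley_dist F S (p i) (p j) = nat \<bar>i - j\<bar>"
    using D(1) labelled_line_dist[OF pl(1)] by (simp add: cayley_dist_eq)
  ultimately show "geodesic_line F S L"
    unfolding geodesic_line_def using pl(2) by (auto simp: edge_def[abs_def])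
qed

lemma edge_inj: "labelled_line p l \<Longrightarrow> inj (edge p)"
proof (rule injI)
  fix i j assume ll: "labelled_line p l" and "edge p i = edge p j"
  then have "p i = p j \<and> p (i + 1) = p (j + 1) \<or> p i = p (j + 1) \<and> p (i + 1) = p j"
    by (simp add: edge_def doubleton_eq_iff)
  then have "i = j \<or> i = j + 1 \<and> i + 1 = j"
    using labelled_line_inj[OF ll] by blast
  then show "i = j"
    by linarith
qed

text \<open>Two vertices of \<open>p\<close> at distance 1 are consecutive on \<open>p\<close>, so
  comparing lines as edge sets reduces to comparing their vertices.\<close>

lemma edge_mem_iff:
  assumes ll: "labelled_line p l" and q: "labelled_line q m"
  shows "edge q i \<in> range (edge p) \<longleftrightarrow> q i \<in> range p \<and> q (i + 1) \<in> range p"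
proof
  assume "edge q i \<in> range (edge p)"
  then show "q i \<in> range p \<and> q (i + 1) \<in> range p"
    by (auto simp: edge_def doubleton_eq_iff)
next
  assume "q i \<in> range p \<and> q (i + 1) \<in> range p"
  then obtain s t where st: "q i = p s" "q (i + 1) = p t"
    by auto
  then have "nat \<bar>s - t\<bar> = 1"
    using labelled_line_dist[OF ll, of s t] labelled_line_dist[OF q, of i "i + 1"] by simp
  then have "t = s + 1 \<or> s = t + 1"
    by linarith
  then have "edge q i = edge p s \<or> edge q i = edge p t"
    using st by (auto simp: edge_def)
  then show "edge q i \<in> range (edge p)"
    by blast
qed

lemma range_edge_eqI:
  assumes "labelled_line p l" "labelled_line q m" "range p = range q"
  shows "range (edge p) = range (edge q)"
proof -
  have "edge q i \<in> range (edge p)" for i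
    unfolding edge_mem_iff[OF assms(1,2)] assms(3) by simp
  moreover have "edge p i \<in> range (edge q)" for i
    unfolding edge_mem_iff[OF assms(2,1)] assms(3)[symmetric] by simp
  ultimately show ?thesis
    by (meson image_subsetI subset_antisym)
qed

lemma edge_translate: "(\<lambda>x. a \<otimes> x) ` edge p i = {a \<otimes> p i, a \<otimes> p (i + 1)}"
  by (simp add: edge_def)

section \<open>Existence and uniqueness of axes\<close>

lemma axis_line_geodesic:
  assumes "axis_line a p l k"
  shows "geodesic_line F S (range (edge p))" "translate_edges F a (range (edge p)) = range (edge p)"
proof -
  have ll: "labelled_line p l" and tr: "\<And>i. a \<otimes> p i = p (i + k)"
    using assms by (auto simp: axis_line_def)
  show "geodesic_line F S (range (edge p))"
    using ll geodesic_line_iff by blast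
  have "(\<lambda>x. a \<otimes> x) ` edge p i = edge p (i + k)" for i
    by (simp add: edge_def tr algebra_simps)
  then have "translate_edges F a (range (edge p)) = edge p ` range (\<lambda>i. i + k)"
    unfolding translate_edges_def image_image by simp
  also have "range (\<lambda>i. i + k) = UNIV"
    by (metis diff_add_cancel surjI)
  finally show "translate_edges F a (range (edge p)) = range (edge p)" .
qed

text \<open>The element acts on the indices of the line by an isometry of the integers. A
  translation gives an axis, reversed if it moves backwards; a reflection would fix a vertex or
  invert an edge.\<close>

lemma invariant_line_axis_line:
  assumes a: "a \<in> carrier F" "a \<noteq> \<one>" and L: "geodesic_line F S L" "translate_edges F a L = L"
  shows "\<exists>p l k. axis_line a p l k \<and> L = range (edge p)"
proof -
  obtain p l where ll: "labelled_line p l" and Lp: "L = range (edge p)"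
    using L(1) unfolding geodesic_line_iff by blast
  note D = labelled_lineD[OF ll]
  have "a \<otimes> p i \<in> range p" for i
  proof -
    have "(\<lambda>x. a \<otimes> x) ` edge p i \<in> L"
      using L(2) Lp unfolding translate_edges_def by blast
    then obtain j where "{a \<otimes> p i, a \<otimes> p (i + 1)} = {p j, p (j + 1)}"
      unfolding edge_translate Lp by (auto simp: edge_def)
    then show ?thesis
      by (metis doubleton_eq_iff rangeI)
  qed
  then have "\<exists>\<tau>. \<forall>i. a \<otimes> p i = p (\<tau> i)"
    by (intro choice) blast
  then obtain \<tau> where \<tau>: "\<And>i. a \<otimes> p i = p (\<tau> i)"
    by blast
  have "nat \<bar>\<tau> i - \<tau> j\<bar> = nat \<bar>i - j\<bar>" for i j
  proof -
    have "inv (p (\<tau> i)) \<otimes> p (\<tau> j) = inv (p i) \<otimes> (inv a \<otimes> (a \<otimes> p j))"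
      using a(1) D(1) by (simp add: \<tau>[symmetric] inv_mult_group m_assoc)
    also have "\<dots> = inv (p i) \<otimes> p j"
      using a(1) D(1)[of j] by (simp add: m_assoc[symmetric])
    finally show ?thesis
      using labelled_line_dist[OF ll] by metis
  qed
  then have "\<bar>\<tau> i - \<tau> j\<bar> = \<bar>i - j\<bar>" for i j
    by (metis abs_ge_zero eq_nat_nat_iff)
  then have "(\<forall>i. \<tau> i = \<tau> 0 + i) \<or> (\<forall>i. \<tau> i = \<tau> 0 - i)"
    by (rule int_isometry)
  then show ?thesis
  proof
    assume 1: "\<forall>i. \<tau> i = \<tau> 0 + i"
    have tr: "a \<otimes> p i = p (i + \<tau> 0)" for i
      using \<tau>[of i] 1[THEN spec, of i] by (metis add.commute)
    have "\<tau> 0 \<noteq> 0"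
    proof
      assume "\<tau> 0 = 0"
      then have "a \<otimes> p 0 = p 0"
        using \<tau>[of 0] by simp
      then show False
        using a D(1)[of 0] by simp
    qed
    then consider "0 < \<tau> 0" | "\<tau> 0 < 0"
      by linarith
    then show ?thesis
    proof cases
      case 1
      then show ?thesis
        using ll tr Lp unfolding axis_line_def by blast
    next
      case 2
      have "axis_line a (\<lambda>i. p (- i)) (\<lambda>i. flip (l (- i - 1))) (- \<tau> 0)"
        using labelled_line_reverse[OF ll] 2 tr by (simp add: axis_line_def)
      moreover have "range (edge p) = range (edge (\<lambda>i. p (- i)))"
      proof (rule range_edge_eqI[OF ll labelled_line_reverse[OF ll]])
        have "range (\<lambda>i :: int. - i) = UNIV"
          by (metis add.inverse_inverse surjI)
        then show "range p = range (\<lambda>i. p (- i))"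
          by (metis image_image)
      qed
      ultimately show ?thesis
        using Lp by blast
    qed
  next
    assume 2: "\<forall>i. \<tau> i = \<tau> 0 - i"
    show ?thesis
    proof (cases "even (\<tau> 0)")
      case True
      then obtain m where "\<tau> 0 = 2 * m"
        by (rule evenE)
      then have "a \<otimes> p m = p m"
        using \<tau>[of m] 2[THEN spec, of m] by simp
      then show ?thesis
        using a D(1)[of m] by simp
    next
      \<comment> \<open>Inverting an edge with label \<open>l m\<close> would make that letter
        square to 1, but the word consisting of \<open>l m\<close> twice is reduced.\<close>
      case False
      then obtain m where m: "\<tau> 0 = 2 * m + 1"
        by (rule oddE)
      have "a \<otimes> p m = p (m + 1)" "a \<otimes> p (m + 1) = p m"
        using \<tau>[of m] 2[THEN spec, of m] \<tau>[of "m + 1"] 2[THEN spec, of "m + 1"] m by simp_all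
      then have "p m \<otimes> (ev (l m) \<otimes> ev (l m)) = p m"
        using D(1)[of m] D(2)[of m] a(1) by (simp add: D(3)[of m] m_assoc[symmetric] del: mem_Sigma_iff)
      then have "ev (l m) \<otimes> ev (l m) = \<one>"
        using D(1)[of m] D(2)[of m] by (simp del: mem_Sigma_iff)
      moreover have "nf (ev (l m) \<otimes> ev (l m)) = [l m, l m]"
        using nf_ev_mult[OF D(2) ev_closed[OF D(2)], of m m] nf_ev[OF D(2), of m] by simp
      ultimately show ?thesis
        by simp
    qed
  qed
qed

lemma axis_line_label_periodic:
  assumes a: "a \<in> carrier F" and line: "axis_line a p l k"
  shows "l (i + k) = l i"
proof -
  have ll: "labelled_line p l" and tr: "\<And>i. a \<otimes> p i = p (i + k)"
    using line by (auto simp: axis_line_def)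
  note D = labelled_lineD[OF ll]
  have "p (i + k) \<otimes> ev (l (i + k)) = p (i + 1 + k)"
    using D(3)[of "i + k"] by (simp add: algebra_simps)
  also have "\<dots> = a \<otimes> (p i \<otimes> ev (l i))"
    using tr[of "i + 1"] D(3)[of i] by simp
  also have "\<dots> = p (i + k) \<otimes> ev (l i)"
    using tr[of i] D(1,2) a by (simp add: m_assoc[symmetric] del: mem_Sigma_iff)
  finally have "ev (l (i + k)) = ev (l i)"
    using D(1)[of "i + k"] ev_closed[OF D(2)] by simp
  then show ?thesis
    by (rule ev_inj[OF D(2) D(2)])
qed

lemma axis_line_displacement_on:
  assumes "axis_line a p l k"
  shows "len (inv (p i) \<otimes> (a \<otimes> p i)) = nat k"
  using assms labelled_line_dist[of p l i "i + k"] by (simp add: axis_line_def)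

text \<open>
  The displacement of a vertex exceeds the translation length by twice its distance to the axis;
  hence the vertices of an axis are exactly those of minimal displacement, which makes it unique.
\<close>

lemma axis_line_displacement:
  assumes a: "a \<in> carrier F" and line: "axis_line a p l k" and x: "x \<in> carrier F"
  shows "\<exists>j. len (inv x \<otimes> (a \<otimes> x)) = nat k + 2 * len (inv (p j) \<otimes> x)"
proof -
  have ll: "labelled_line p l" and k: "0 < k" and tr: "\<And>i. a \<otimes> p i = p (i + k)"
    using line by (auto simp: axis_line_def)
  note D = labelled_lineD[OF ll]
  \<comment> \<open>A nearest vertex of the axis: the path \<open>z\<close> from it to
    \<open>x\<close> then leaves the axis at once.\<close>
  obtain j where min: "\<And>i. len (inv (p j) \<otimes> x) \<le> len (inv (p i) \<otimes> x)"
    using ex_has_least_nat[of "\<lambda>_. True" 0 "\<lambda>i. len (inv (p i) \<otimes> x)"] by blast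
  define z where "z = inv (p j) \<otimes> x"
  have z: "z \<in> carrier F"
    using D(1) x by (simp add: z_def)
  have away: "hd (nf z) \<noteq> flip m" if "nf z \<noteq> []" "m \<in> S \<times> UNIV" "inv (p i) \<otimes> x = ev m \<otimes> z" for m i
  proof
    assume "hd (nf z) = flip m"
    then have "len (ev m \<otimes> z) = len z - 1" "len z > 0"
      using nf_ev_mult[OF that(2) z] that(1) by (simp_all add: len_nf)
    then show False
      using min[of i] that(3) by (simp add: z_def)
  qed
  have "hd (nf z) \<noteq> l j" if "nf z \<noteq> []"
  proof -
    have "inv (p (j + 1)) \<otimes> x = ev (flip (l j)) \<otimes> z"
      using D(1,2) x by (simp add: D(3) z_def ev_flip inv_mult_group m_assoc del: mem_Sigma_iff)
    then show ?thesis
      using away[OF that, of "flip (l j)" "j + 1"] D(2)[of j] by simp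
  qed
  have 2: "hd (nf z) \<noteq> flip (l (j - 1))" if "nf z \<noteq> []"
  proof -
    have "p (j - 1) \<otimes> ev (l (j - 1)) = p j"
      using D(3)[of "j - 1"] by simp
    then have "inv (p j) = inv (ev (l (j - 1))) \<otimes> inv (p (j - 1))"
      using D(1,2) by (metis inv_mult_group ev_closed)
    then have "inv (p (j - 1)) \<otimes> x = ev (l (j - 1)) \<otimes> z"
      using D(1) x ev_closed[OF D(2)] by (simp add: z_def m_assoc) (simp add: m_assoc[symmetric])
    then show ?thesis
      using away[OF that] D(2) by blast
  qed
  define ls where "ls = labels l j (nat k)"
  have red: "ls \<in> reduced_words S"
    unfolding ls_def by (rule labels_reduced[OF ll])
  have ls: "ls \<noteq> []" "hd ls = l j" "last ls = l (j - 1)"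
  proof -
    show "ls \<noteq> []"
      using k by (metis length_labels ls_def list.size(3) zero_less_nat_eq less_irrefl)
    show "hd ls = l j"
      using k by (simp add: ls_def hd_labels)
    show "last ls = l (j - 1)"
      using k axis_line_label_periodic[OF a line, of "j - 1"]
      by (simp add: ls_def last_labels algebra_simps)
  qed
  \<comment> \<open>The path from \<open>x\<close> to its translate goes to the axis, along one
    period, and off again; no cancellation occurs at the two junctions.\<close>
  let ?W = "rev (map flip (nf z)) @ ls @ nf z"
  have "?W \<in> reduced_words S"
    using reduced_words_rev_flip[OF nf_reduced[OF z]] red nf_reduced[OF z] ls 2
      \<open>nf z \<noteq> [] \<Longrightarrow> hd (nf z) \<noteq> l j\<close>
    by (auto simp: reduced_words_append last_rev hd_map)
  moreover have "eval ?W = inv x \<otimes> (a \<otimes> x)"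
  proof -
    have "inv (p j) \<otimes> (a \<otimes> p j) = eval ls"
      using labelled_line_diff[OF ll, of j "nat k"] k by (simp add: tr ls_def)
    moreover have "set (rev (map flip (nf z))) \<subseteq> S \<times> UNIV"
      using nf_letters[OF z] by simp
    ultimately have "eval ?W = inv z \<otimes> (inv (p j) \<otimes> (a \<otimes> p j) \<otimes> z)"
      using z nf_letters[OF z] reduced_letters[OF red]
      by (simp only: eval_append eval_rev_flip eval_nf set_append Un_subset_iff simp_thms)
    moreover have "x = p j \<otimes> z"
      using D(1) x by (simp add: z_def m_assoc[symmetric])
    ultimately show ?thesis
      using D(1) z a by (simp add: m_assoc inv_mult_group)
  qed
  ultimately have "len (inv x \<otimes> (a \<otimes> x)) = length ?W"
    by (metis len_eval)
  also have "length ?W = nat k + 2 * len z"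
    by (simp add: ls_def len_nf)
  finally show ?thesis
    unfolding z_def by blast
qed

lemma axis_line_vertex_iff:
  assumes a: "a \<in> carrier F" and line: "axis_line a p l k" and x: "x \<in> carrier F"
  shows "x \<in> range p \<longleftrightarrow> len (inv x \<otimes> (a \<otimes> x)) = nat k"
proof
  assume "x \<in> range p"
  then show "len (inv x \<otimes> (a \<otimes> x)) = nat k"
    using axis_line_displacement_on[OF line] by blast
next
  assume eq: "len (inv x \<otimes> (a \<otimes> x)) = nat k"
  have pcl: "p j \<in> carrier F" for j
    using line labelled_lineD(1)[of p l] by (simp add: axis_line_def)
  obtain j where "len (inv (p j) \<otimes> x) = 0"
    using axis_line_displacement[OF assms] eq by auto
  then have "inv (p j) \<otimes> x = \<one>"
    using pcl x by (simp add: len_eq_0_iff)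
  then have "x = p j"
    using pcl x by (metis inv_equality inv_inv inv_closed)
  then show "x \<in> range p"
    by blast
qed

lemma axis_line_unique:
  assumes a: "a \<in> carrier F" and lines: "axis_line a p l k" "axis_line a q m n"
  shows "range (edge p) = range (edge q)"
proof -
  have ll: "labelled_line p l" "labelled_line q m"
    using lines by (auto simp: axis_line_def)
  note D = labelled_lineD(1)[OF ll(1)] labelled_lineD(1)[OF ll(2)]
  have "nat n \<le> nat k"
    using axis_line_displacement[OF a lines(2) D(1)[of 0]] axis_line_displacement_on[OF lines(1), of 0]
    by auto
  moreover have "nat k \<le> nat n"
    using axis_line_displacement[OF a lines(1) D(2)[of 0]] axis_line_displacement_on[OF lines(2), of 0]
    by auto
  ultimately have "x \<in> range p \<longleftrightarrow> x \<in> range q" if "x \<in> carrier F" for x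
    using axis_line_vertex_iff[OF a lines(1) that] axis_line_vertex_iff[OF a lines(2) that] by simp
  then have "range p = range q"
    using D by blast
  then show ?thesis
    by (rule range_edge_eqI[OF ll])
qed

text \<open>A conjugate \<open>u\<close> of \<open>a\<close> of minimal length is cyclically
  reduced, so its powers concatenate without cancellation to a line; translating by the conjugator
  \<open>c\<close> yields the axis of \<open>a\<close>.\<close>

lemma axis_line_exists:
  assumes a: "a \<in> carrier F" "a \<noteq> \<one>"
  shows "\<exists>p l k. axis_line a p l k"
proof -
  obtain c where c: "c \<in> carrier F"
    and min: "\<And>x. x \<in> carrier F \<Longrightarrow> len (inv c \<otimes> (a \<otimes> c)) \<le> len (inv x \<otimes> (a \<otimes> x))"
    using ex_has_least_nat[of "\<lambda>x. x \<in> carrier F" \<one> "\<lambda>x. len (inv x \<otimes> (a \<otimes> x))"] by blast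
  define u where "u = inv c \<otimes> (a \<otimes> c)"
  have u: "u \<in> carrier F" "a \<otimes> c = c \<otimes> u"
    using a c by (simp_all add: u_def m_assoc[symmetric])
  have "u \<noteq> \<one>"
    using u(2) a c by auto
  define U where "U = nf u"
  have U: "U \<noteq> []" "U \<in> reduced_words S" "eval U = u"
    using u \<open>u \<noteq> \<one>\<close> by (simp_all add: U_def nf_eq_Nil_iff nf_reduced eval_nf)
  have cyc: "hd U \<noteq> flip (last U)"
  proof
    assume eq: "hd U = flip (last U)"
    obtain m V where mV: "U = m # V"
      using U(1) by (cases U) auto
    then have "V \<noteq> []"
      using eq by auto
    then obtain V' where V: "V = V' @ [flip m]"
      using eq mV by (metis append_butlast_last_id flip_flip last_ConsR list.sel(1))
    have V': "set V' \<subseteq> S \<times> UNIV" "m \<in> S \<times> UNIV"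
      using reduced_letters[OF U(2)] mV V by auto
    have "u = ev m \<otimes> (eval V' \<otimes> inv (ev m))"
      using U(3) V' by (simp add: mV V eval_append ev_flip)
    \<comment> \<open>Equal and opposite end letters would allow a further conjugation by
      \<open>m\<close> that shortens \<open>u\<close>.\<close>
    then have "inv (c \<otimes> ev m) \<otimes> (a \<otimes> (c \<otimes> ev m)) = eval V'"
      using u(2) a c V' u(1) by (simp add: inv_mult_group m_assoc[symmetric]) (simp add: m_assoc)
    then have "len u \<le> length V'"
      using min[of "c \<otimes> ev m"] len_eval_le[OF V'(1)] c V'(2) by (simp add: u_def)
    then show False
      using mV V by (simp add: len_nf U_def[symmetric])
  qed
  define n where "n = int (length U)"
  have n: "0 < n"
    using U(1) by (simp add: n_def)
  define l where "l = (\<lambda>i. U ! nat (i mod n))"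
  \<comment> \<open>The quotient counts full periods and the remainder is the position within the
    current copy of \<open>U\<close>.\<close>
  define p where "p = (\<lambda>i. c \<otimes> (u [^] (i div n) \<otimes> eval (take (nat (i mod n)) U)))"
  have tk: "eval (take j U) \<in> carrier F" for j
    using reduced_letters[OF U(2)] set_take_subset[of j U] by (intro eval_closed) blast
  have l: "l i \<in> S \<times> UNIV" for i
  proof -
    have "nat (i mod n) < length U"
      using n by (simp add: n_def nat_less_iff)
    then show ?thesis
      using reduced_letters[OF U(2)] unfolding l_def by (meson nth_mem subsetD)
  qed
  have step: "i div n = (i + 1) div n \<and> (i + 1) mod n = i mod n + 1 \<and> i mod n + 1 < n \<or>
      (i + 1) div n = i div n + 1 \<and> (i + 1) mod n = 0 \<and> i mod n = n - 1" for i
  proof (cases "i mod n + 1 < n")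
    case True
    then have "(i + 1) mod n = i mod n + 1"
      using n by (metis mod_add_left_eq mod_pos_pos_trivial pos_mod_sign add_increasing2 zero_le_one)
    moreover have "(i + 1) div n = i div n"
      using calculation div_mult_mod_eq[of "i + 1" n] div_mult_mod_eq[of i n] n
      by (metis add.assoc add_right_cancel mult_right_cancel less_irrefl)
    ultimately show ?thesis
      using True by simp
  next
    case False
    then have im: "i mod n = n - 1"
      using pos_mod_bound[OF n, of i] by linarith
    then have "i + 1 = (i div n + 1) * n"
      using div_mult_mod_eq[of i n] unfolding distrib_right by linarith
    then show ?thesis
      using im n by (metis mod_mult_self2_is_0 nonzero_mult_div_cancel_right less_irrefl)
  qed
  have tkS: "eval (take (Suc j) U) = eval (take j U) \<otimes> ev (U ! j)" if "j < length U" for j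
  proof -
    have "U ! j \<in> S \<times> UNIV" "set (take j U) \<subseteq> S \<times> UNIV"
      using reduced_letters[OF U(2)] that set_take_subset[of j U] by (meson nth_mem subsetD, blast)
    then show ?thesis
      using that by (simp add: take_Suc_conv_app_nth eval_append del: mem_Sigma_iff)
  qed
  have pS: "p (i + 1) = p i \<otimes> ev (l i)" for i
  proof -
    have lt: "nat (i mod n) < length U"
      using n by (simp add: n_def nat_less_iff)
    have "p i \<otimes> ev (l i) = c \<otimes> (u [^] (i div n) \<otimes> eval (take (Suc (nat (i mod n))) U))"
      using c u(1) tk ev_closed[OF l] unfolding tkS[OF lt] by (simp add: p_def l_def m_assoc)
    moreover have "p (i + 1) = \<dots>"
      using step[of i]
    proof
      assume *: "i div n = (i + 1) div n \<and> (i + 1) mod n = i mod n + 1 \<and> i mod n + 1 < n"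
      then have "nat ((i + 1) mod n) = Suc (nat (i mod n))"
        using n by (simp add: nat_add_distrib)
      then show ?thesis
        using * by (simp add: p_def)
    next
      assume *: "(i + 1) div n = i div n + 1 \<and> (i + 1) mod n = 0 \<and> i mod n = n - 1"
      then have "Suc (nat (i mod n)) = length U"
        using n unfolding n_def by linarith
      then show ?thesis
        using * u(1) U(3) by (simp add: p_def int_pow_mult)
    qed
    ultimately show ?thesis
      by simp
  qed
  have "l (i + 1) \<noteq> flip (l i)" for i
    using step[of i]
  proof
    assume *: "i div n = (i + 1) div n \<and> (i + 1) mod n = i mod n + 1 \<and> i mod n + 1 < n"
    then have "nat ((i + 1) mod n) = Suc (nat (i mod n))"
      using n by (simp add: nat_add_distrib)
    moreover have "Suc (nat (i mod n)) < length U"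
    proof -
      have "int (Suc (nat (i mod n))) < n"
        using * n by simp
      then show ?thesis
        unfolding n_def of_nat_less_iff .
    qed
    ultimately show ?thesis
      using U(2) by (simp add: l_def reduced_words_iff successively_conv_nth)
  next
    assume *: "(i + 1) div n = i div n + 1 \<and> (i + 1) mod n = 0 \<and> i mod n = n - 1"
    then have "nat (i mod n) = length U - 1"
      using n unfolding n_def by linarith
    then show ?thesis
      using * cyc U(1) by (simp add: l_def hd_conv_nth last_conv_nth)
  qed
  then have "labelled_line p l"
    using pS l c u(1) tk by (auto simp: labelled_line_def p_def simp del: mem_Sigma_iff)
  moreover have "a \<otimes> p i = p (i + n)" for i
  proof -
    have "u [^] ((i + n) div n) = u \<otimes> u [^] (i div n)"
      using n u(1) int_pow_mult[of u 1 "i div n"] by (simp add: int_pow_1 add.commute)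
    moreover have "a \<otimes> p i = a \<otimes> c \<otimes> (u [^] (i div n) \<otimes> eval (take (nat (i mod n)) U))"
      using a c u(1) tk by (simp add: p_def m_assoc)
    ultimately show ?thesis
      using c u tk by (simp add: p_def m_assoc)
  qed
  ultimately show ?thesis
    using n unfolding axis_line_def by blast
qed

lemma axis_eq:
  assumes a: "a \<in> carrier F" "a \<noteq> \<one>" and line: "axis_line a p l k"
  shows "axis F S a = range (edge p)"
  unfolding axis_def
proof (rule the_equality)
  show "geodesic_line F S (range (edge p)) \<and> translate_edges F a (range (edge p)) = range (edge p)"
    using axis_line_geodesic[OF line] by blast
next
  fix L assume L: "geodesic_line F S L \<and> translate_edges F a L = L"
  obtain q m n where q: "axis_line a q m n" "L = range (edge q)"
    using invariant_line_axis_line[OF a conjunct1[OF L] conjunct2[OF L]] by blast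
  then show "L = range (edge p)"
    using axis_line_unique[OF a(1) line q(1)] by simp
qed

subsection \<open>Overlapping axes\<close>

text \<open>The displacement of 1 is \<open>|w|\<close>, at least the translation length;
  conjugating by a vertex of the axis and using minimality gives the reverse inequality. So 1 has
  minimal displacement, lies on the axis, and can be given index 0.\<close>

lemma minimizing_axis_line:
  assumes min: "minimizing_basis F S w" and w: "w \<in> carrier F" "w \<noteq> \<one>"
  shows "\<exists>q m. axis_line w q m (int (len w)) \<and> q 0 = \<one>"
proof -
  obtain q m n where line: "axis_line w q m n"
    using axis_line_exists[OF w] by blast
  then have ll: "labelled_line q m" and n: "0 < n"
    by (auto simp: axis_line_def)
  note q = labelled_lineD(1)[OF ll]
  have "nat n \<le> len (inv \<one> \<otimes> (w \<otimes> \<one>))"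
    using axis_line_displacement[OF w(1) line one_closed] by auto
  moreover have "len w \<le> nat n"
    using minimizing_len_le[OF min conj_iso[OF q[of 0]] w(1)] axis_line_displacement_on[OF line, of 0]
      w(1) q[of 0] by (simp add: m_assoc)
  ultimately have eq: "len w = nat n"
    using w(1) by simp
  then have "\<one> \<in> range q"
    using axis_line_vertex_iff[OF w(1) line one_closed] w(1) by simp
  then obtain c where c: "q c = \<one>"
    by (metis imageE)
  have "axis_line w (\<lambda>i. q (i + c)) (\<lambda>i. m (i + c)) n"
    using line labelled_line_shift[OF ll, of c] by (simp add: axis_line_def algebra_simps)
  moreover have "int (len w) = n"
    using eq n by simp
  ultimately show ?thesis
    using c by (intro exI[of _ "\<lambda>i. q (i + c)"] exI[of _ "\<lambda>i. m (i + c)"]) simp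
qed

text \<open>Since \<open>q 0\<close> is 1, the first \<open>|w|\<close> labels spell
  \<open>w\<close>, and periodicity closes them to a cyclic word; the test property makes every
  generator occur among them.\<close>

lemma axis_whitehead_graph_no_cut_vertex:
  assumes min: "minimizing_basis F S w" and test: "test_element_mono F w"
    and line: "axis_line w q m (int (len w))" and q0: "q 0 = \<one>"
    and x: "x \<in> S \<times> UNIV" and AB: "A \<union> B = S \<times> UNIV - {x}" "A \<inter> B = {}" "A \<noteq> {}" "B \<noteq> {}"
  shows "\<exists>i. flip (m (i - 1)) \<in> A \<and> m i \<in> B \<or> flip (m (i - 1)) \<in> B \<and> m i \<in> A"
proof -
  have w: "w \<in> carrier F"
    using test by (simp add: test_element_mono_def)
  have ll: "labelled_line q m"
    using line by (simp add: axis_line_def)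
  let ?l = "\<lambda>i. m (int i)"
  have lab: "labels m 0 (len w) = map ?l [0..<len w]"
    by (simp add: labels_def)
  have "q (0 + int (len w)) = w \<otimes> q 0"
    using line unfolding axis_line_def by metis
  then have weq: "w = eval (map ?l [0..<len w])"
    using labelled_line_path[OF ll, of 0 "len w"] w q0 reduced_letters[OF labels_reduced[OF ll, of 0 "len w"]]
    by (simp add: lab)
  have red: "map ?l [0..<len w] \<in> reduced_words S"
    using labels_reduced[OF ll, of 0 "len w"] by (simp add: lab)
  have nfw: "nf w = map ?l [0..<len w]"
    using nf_eval[OF red] weq by simp
  have "?l (len w) = ?l 0"
    using axis_line_label_periodic[OF w line, of 0] by simp
  moreover have "\<exists>i<len w. fst (?l i) = s" if "s \<in> S" for s
  proof -
    have "s \<in> fst ` set (map ?l [0..<len w])"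
      using generator_occurs[OF test that] nfw by simp
    then show ?thesis
      by auto
  qed
  ultimately obtain i where i: "flip (?l i) \<in> A \<and> ?l (Suc i) \<in> B \<or> flip (?l i) \<in> B \<and> ?l (Suc i) \<in> A"
    using whitehead_graph_no_cut_vertex[OF min weq refl _ labelled_lineD(2)[OF ll] _ x AB] by blast
  \<comment> \<open>The turn between letters \<open>i\<close> and \<open>i + 1\<close> of the word
    is the turn of the line at index \<open>i + 1\<close>.\<close>
  have "int (Suc i) - 1 = int i"
    by simp
  then show ?thesis
    using i by metis
qed

text \<open>Between two common vertices both lines spell the same group element by a reduced word,
  and such a word is unique; if the lines run in opposite directions, \<open>p\<close> is reversed
  first.\<close>

lemma line_meet_convex:
  assumes ll: "labelled_line p l" and q: "labelled_line q m"
    and ends: "q i \<in> range p" "q j \<in> range p" and t: "i \<le> t" "t \<le> j"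
  shows "q t \<in> range p"
proof -
  have *: "q t \<in> range p"
    if p: "labelled_line p l" and ends: "q i = p s" "q j = p s'" and "s \<le> s'" for p l s s'
  proof -
    have "nat \<bar>s - s'\<bar> = nat \<bar>i - j\<bar>"
      using labelled_line_dist[OF p, of s s'] labelled_line_dist[OF q, of i j] ends by simp
    then have len: "s' = s + int (nat (j - i))" "j = i + int (nat (j - i))"
      using t \<open>s \<le> s'\<close> by linarith+
    have "eval (labels m i (nat (j - i))) = eval (labels l s (nat (j - i)))"
      using labelled_line_diff[OF q, of i "nat (j - i)"] labelled_line_diff[OF p, of s "nat (j - i)"]
        len ends by simp
    then have eq: "labels m i (nat (j - i)) = labels l s (nat (j - i))"
      using nf_eval[OF labels_reduced[OF q]] nf_eval[OF labels_reduced[OF p]] by metis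
    have tk: "take n (labels k c N) = labels k c n" if "n \<le> N" for k c n N
      using that by (simp add: labels_def take_map)
    have "labels m i (nat (t - i)) = labels l s (nat (t - i))"
      using arg_cong[OF eq, of "take (nat (t - i))"] t by (simp add: tk nat_le_iff)
    then have "q (i + int (nat (t - i))) = p (s + int (nat (t - i)))"
      using labelled_line_path[OF q, of i "nat (t - i)"] labelled_line_path[OF p, of s "nat (t - i)"] ends
      by simp
    then show ?thesis
      using t by auto
  qed
  obtain s s' where s: "q i = p s" "q j = p s'"
    using ends by blast
  show ?thesis
  proof (cases "s \<le> s'")
    case True
    then show ?thesis
      using *[OF ll s] by blast
  next
    case False
    then have "q t \<in> range (\<lambda>i. p (- i))"
      using *[OF labelled_line_reverse[OF ll], of "- s" "- s'"] s by simp
    then show ?thesis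
      by auto
  qed
qed

text \<open>Three consecutive vertices of \<open>q\<close> on \<open>p\<close> are consecutive there
  too, in the same or the opposite order. Since turns are unordered, the two orders give the two
  alternatives.\<close>

lemma line_turn:
  assumes ll: "labelled_line p l" and q: "labelled_line q m"
    and r: "q (t - 1) \<in> range p" "q t \<in> range p" "q (t + 1) \<in> range p"
  shows "\<exists>i. flip (l (i - 1)) = flip (m (t - 1)) \<and> l i = m t \<or> flip (l (i - 1)) = m t \<and> l i = flip (m (t - 1))"
proof -
  have out: "q' (t + 1) = p (s + 1) \<Longrightarrow> m' t = l s" "q' (t + 1) = p (s - 1) \<Longrightarrow> m' t = flip (l (s - 1))"
    if "labelled_line q' m'" "q' t = p s" for q' m' t s
  proof -
    note D = labelled_lineD[OF ll] and D' = labelled_lineD[OF that(1)]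
    {
      assume "q' (t + 1) = p (s + 1)"
      then have "ev (m' t) = ev (l s)"
        using that(2) D'(3)[of t] D(3)[of s] D(1) ev_closed[OF D(2)] ev_closed[OF D'(2)] by simp
      then show "m' t = l s"
        by (rule ev_inj[OF D'(2) D(2)])
    }
    {
      assume *: "q' (t + 1) = p (s - 1)"
      have "p (s - 1) = p s \<otimes> ev (flip (l (s - 1)))"
        using D(3)[of "s - 1"] D(1)[of "s - 1"] D(2)[of "s - 1"]
        by (simp add: ev_flip m_assoc del: mem_Sigma_iff)
      then have "ev (m' t) = ev (flip (l (s - 1)))"
        using that(2) * D'(3)[of t] D(1) ev_closed[OF D'(2)] D(2)[of "s - 1"]
        by (simp del: mem_Sigma_iff)
      moreover have "flip (l (s - 1)) \<in> S \<times> UNIV"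
        using D(2)[of "s - 1"] by simp
      ultimately show "m' t = flip (l (s - 1))"
        by (rule ev_inj[OF D'(2), rotated])
    }
  qed
  obtain s s1 s2 where s: "q t = p s" "q (t + 1) = p s1" "q (t - 1) = p s2"
    using r by blast
  note out_back = out[OF labelled_line_reverse[OF q], of "- t" s]
  have "nat \<bar>s - s1\<bar> = 1" "nat \<bar>s - s2\<bar> = 1" "nat \<bar>s1 - s2\<bar> = 2"
    using labelled_line_dist[OF ll, of s s1] labelled_line_dist[OF q, of t "t + 1"]
      labelled_line_dist[OF ll, of s s2] labelled_line_dist[OF q, of t "t - 1"]
      labelled_line_dist[OF ll, of s1 s2] labelled_line_dist[OF q, of "t + 1" "t - 1"] s by simp_all
  then consider "s1 = s + 1" "s2 = s - 1" | "s1 = s - 1" "s2 = s + 1"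
    by linarith
  then show ?thesis
  proof cases
    case 1
    then have "m t = l s" "flip (m (t - 1)) = flip (l (s - 1))"
      using out(1)[OF q s(1)] s out_back(2) by simp_all
    then show ?thesis
      by (intro exI[of _ s]) simp
  next
    case 2
    then have "m t = flip (l (s - 1))" "flip (m (t - 1)) = l s"
      using out(2)[OF q s(1)] s out_back(1) by simp_all
    then show ?thesis
      by (intro exI[of _ s]) simp
  qed
qed

lemma card_int_set_spread:
  fixes J :: "int set"
  assumes "enat (n + 1) \<le> (if finite J then enat (card J) else \<infinity>)"
  shows "\<exists>i \<in> J. \<exists>j \<in> J. i + int n \<le> j"
proof -
  have "\<exists>K. K \<subseteq> J \<and> finite K \<and> card K = n + 1"
  proof (cases "finite J")
    case True
    then show ?thesis
      using assms obtain_subset_with_card_n[of "n + 1" J] finite_subset by (metis enat_ord_simps(1))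
  next
    case False
    then show ?thesis
      using infinite_arbitrarily_large by blast
  qed
  then obtain K where K: "K \<subseteq> J" "finite K" "card K = n + 1"
    by blast
  then have "K \<noteq> {}"
    by auto
  have "K \<subseteq> {Min K..Max K}"
    using K(2) by auto
  then have "card K \<le> card {Min K..Max K}"
    by (rule card_mono[rotated]) simp
  then have "Min K + int n \<le> Max K"
    using K(3) by simp
  moreover have "Min K \<in> J" "Max K \<in> J"
    using K(1) Min_in[OF K(2) \<open>K \<noteq> {}\<close>] Max_in[OF K(2) \<open>K \<noteq> {}\<close>] by auto
  ultimately show ?thesis
    by blast
qed

text \<open>The labels of \<open>q\<close> have period \<open>n\<close>, so it is enough that
  \<open>n\<close> consecutive vertices of \<open>q\<close> are interior to the overlap; this takes
  \<open>n + 1\<close> edges.\<close>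

lemma turns_of_axis_overlap:
  assumes w: "w \<in> carrier F" and p: "labelled_line p l" and line: "axis_line w q m (int n)"
    and big: "enat (n + 1) \<le> num_edges (range (edge p) \<inter> range (edge q))"
  shows "\<exists>i. flip (l (i - 1)) = flip (m (t - 1)) \<and> l i = m t \<or> flip (l (i - 1)) = m t \<and> l i = flip (m (t - 1))"
proof -
  have q: "labelled_line q m" and n: "0 < n"
    using line by (auto simp: axis_line_def)
  define J where "J = {i. edge q i \<in> range (edge p)}"
  have "range (edge p) \<inter> range (edge q) = edge q ` J"
    by (auto simp: J_def)
  moreover have inj: "inj_on (edge q) J"
    using edge_inj[OF q] by (rule inj_on_subset) simp
  ultimately have "num_edges (range (edge p) \<inter> range (edge q)) =
      (if finite J then enat (card J) else \<infinity>)"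
    by (simp add: num_edges_def card_image finite_image_iff)
  then obtain i j where ij: "i \<in> J" "j \<in> J" "i + int n \<le> j"
    using card_int_set_spread[of n J] big by metis
  \<comment> \<open>The common edges \<open>i\<close> and \<open>j\<close> have outer endpoints
    \<open>q i\<close> and \<open>q (j + 1)\<close>, which explains the \<open>+ 1\<close>.\<close>
  have mem: "q u \<in> range p" if "i \<le> u" "u \<le> j + 1" for u
    using line_meet_convex[OF p q _ _ that] ij edge_mem_iff[OF p q] by (simp add: J_def)
  \<comment> \<open>The representative of \<open>t\<close> modulo \<open>n\<close> among
    \<open>i + 1, ..., i + n\<close>, where both neighbours still lie on \<open>p\<close>.\<close>
  define u where "u = i + 1 + (t - i - 1) mod int n"
  have u: "i + 1 \<le> u" "u \<le> i + int n"
    using n pos_mod_bound[of "int n" "t - i - 1"] pos_mod_sign[of "int n" "t - i - 1"]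
    unfolding u_def by linarith+
  have per: "m (v + c * int n) = m v" for v and c :: int
  proof -
    have nat: "m (v + int c * int n) = m v" for v and c :: nat
    proof (induction c)
      case (Suc c)
      then show ?case
        using axis_line_label_periodic[OF w line, of "v + int c * int n"] by (simp add: algebra_simps)
    qed simp
    show ?thesis
      using nat[of v "nat c"] nat[of "v + c * int n" "nat (- c)"] by (cases "0 \<le> c") simp_all
  qed
  have "t = u + (t - i - 1) div int n * int n"
    using div_mult_mod_eq[of "t - i - 1" "int n"] by (simp add: u_def)
  then have "m t = m u" "m (t - 1) = m (u - 1)"
    using per[of u] per[of "u - 1"] by (metis, metis add_diff_eq diff_add_eq)
  moreover have "q (u - 1) \<in> range p" "q u \<in> range p" "q (u + 1) \<in> range p"
    using mem u ij(3) by simp_all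
  ultimately show ?thesis
    using line_turn[OF p q, of u] by simp
qed

end

text \<open>Finitely many letters over \<open>S\<close> suffice to spell the elements of
  \<open>B\<close>, hence all of the group; but each \<open>s\<close> in \<open>S\<close> is spelled
  only by itself.\<close>

lemma (in group) finite_basis:
  assumes B: "free_basis G B" "finite B" and S: "free_basis G S"
  shows "finite S"
proof -
  interpret B: based_free_group G B
    using B(1) by unfold_locales
  interpret S: based_free_group G S
    using S by unfold_locales
  define T where "T = (\<Union>b \<in> B. fst ` set (S.nf b))"
  have "finite T"
    using B(2) by (simp add: T_def)
  have letters: "fst ` set (S.nf (x \<otimes> y)) \<subseteq> T"
    if "x \<in> carrier G" "y \<in> carrier G" "fst ` set (S.nf x) \<subseteq> T" "fst ` set (S.nf y) \<subseteq> T" for x y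
    using that
  proof (induction "S.nf x" arbitrary: x)
    case Nil
    then show ?case
      by (metis S.nf_eq_Nil_iff l_one)
  next
    case (Cons l ws)
    have l: "l \<in> S \<times> UNIV" and red: "ws \<in> reduced_words S"
      using S.nf_reduced[OF Cons.prems(1)] Cons.hyps(2)[symmetric] by (auto simp: reduced_words_Cons)
    define z where "z = S.eval ws"
    have z: "z \<in> carrier G" "S.nf z = ws" "x = S.ev l \<otimes> z"
      using red S.eval_nf[OF Cons.prems(1)] Cons.hyps(2)[symmetric]
      by (simp_all add: z_def S.nf_eval S.reduced_letters)
    have "fst ` set (S.nf (z \<otimes> y)) \<subseteq> T"
      using Cons.hyps(1)[of z] z Cons.prems Cons.hyps(2)[symmetric] by simp
    moreover have "x \<otimes> y = S.ev l \<otimes> (z \<otimes> y)"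
      using z l Cons.prems by (simp add: m_assoc)
    moreover have "fst l \<in> T"
      using Cons.prems(3) Cons.hyps(2)[symmetric] by simp
    moreover have "set (S.nf (S.ev l \<otimes> (z \<otimes> y))) \<subseteq> insert l (set (S.nf (z \<otimes> y)))"
      using S.nf_ev_mult[OF l, of "z \<otimes> y"] z(1) Cons.prems(2)
      by (auto simp: list.set_sel(2))
    ultimately show ?case
      by fastforce
  qed
  have "fst ` set (S.nf g) \<subseteq> T" if "g \<in> carrier G" for g
    using that
  proof (induction g rule: B.word_induct)
    case (mult l h)
    have "fst ` set (S.nf (B.ev l)) \<subseteq> T"
    proof -
      have b: "fst l \<in> B" "fst l \<in> carrier G"
        using mult(1) B.S_closed by auto
      then have "fst ` set (S.nf (fst l)) \<subseteq> T"
        by (auto simp: T_def)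
      moreover have "fst ` set (S.nf (inv (fst l))) = fst ` set (S.nf (fst l))"
        using b by (simp add: S.nf_inv image_image)
      ultimately show ?thesis
        by (simp add: B.ev_def)
    qed
    then show ?case
      using letters mult by simp
  qed simp
  moreover have "s \<in> fst ` set (S.nf s)" if "s \<in> S" for s
    using S.nf_ev[of "(s, True)"] that by (simp add: S.ev_def)
  ultimately have "s \<in> T" if "s \<in> S" for s
    using that S.S_closed by (meson subsetD)
  then have "S \<subseteq> T"
    by (rule subsetI)
  then show ?thesis
    using \<open>finite T\<close> by (rule finite_subset)
qed

text \<open>With at most one generator in \<open>S\<close> the group would be commutative, whereas
  two distinct elements of \<open>B\<close> give two distinct reduced words \<open>b c\<close> and
  \<open>c b\<close>.\<close>

lemma (in group) basis_two_elements:
  assumes B: "free_basis G B" "b \<in> B" "c \<in> B" "b \<noteq> c" and S: "free_basis G S"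
  shows "\<exists>s \<in> S. \<exists>t \<in> S. s \<noteq> t"
proof (rule ccontr)
  interpret B: based_free_group G B
    using B(1) by unfold_locales
  interpret S: based_free_group G S
    using S by unfold_locales
  assume not: "\<not> ?thesis"
  have gen: "x \<otimes> s = s \<otimes> x" if x: "x \<in> carrier G" and s: "s \<in> S" for x s
    using x
  proof (induction x rule: S.word_induct)
    case one
    then show ?case
      using s S.S_closed by auto
  next
    case (mult l h)
    have sG: "s \<in> carrier G"
      using s S.S_closed by blast
    have "fst l = s"
      using mult(1) s not by auto
    then have "S.ev l \<otimes> s = s \<otimes> S.ev l"
      using sG by (auto simp: S.ev_def)
    then show ?case
      using mult sG by (metis S.ev_closed m_assoc)
  qed
  have comm: "x \<otimes> y = y \<otimes> x" if x: "x \<in> carrier G" and y: "y \<in> carrier G" for x y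
    using y
  proof (induction y rule: S.word_induct)
    case (mult l h)
    have sG: "fst l \<in> S" "fst l \<in> carrier G"
      using mult(1) S.S_closed by auto
    have "fst l \<otimes> (x \<otimes> inv (fst l)) = x \<otimes> (fst l \<otimes> inv (fst l))"
      using gen[OF x sG(1)] sG(2) x by (simp only: m_assoc[symmetric] inv_closed)
    then have "x \<otimes> inv (fst l) = inv (fst l) \<otimes> x"
      using sG(2) x by (simp add: inv_solve_left)
    then have "x \<otimes> S.ev l = S.ev l \<otimes> x"
      using gen[OF x sG(1)] by (simp add: S.ev_def)
    then show ?case
      using mult x by (metis S.ev_closed m_assoc)
  qed (use x in simp)
  have bc: "b \<in> carrier G" "c \<in> carrier G"
    using B B.S_closed by auto
  have "B.nf (B.eval [(b, True), (c, True)]) = [(b, True), (c, True)]"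
    "B.nf (B.eval [(c, True), (b, True)]) = [(c, True), (b, True)]"
    using B(2-4) by (intro B.nf_eval; simp add: reduced_words_Cons flip_def)+
  then show False
    using comm[OF bc] bc B(4) by (simp add: B.ev_def)
qed

theorem theorem3p4:
  fixes F :: "('a, 'b) monoid_scheme" and r :: nat and w a :: 'a and S :: "'a set"
  assumes "r \<ge> 2"
    and "free_group_of_rank F r"
    and "test_element_mono F w"
    and "minimizing_basis F S w"
    and "a \<in> carrier F" and "a \<noteq> \<one>\<^bsub>F\<^esub>"
    and "num_edges (axis F S a \<inter> axis F S w) \<ge> enat (word_length F S w + 1)"
  shows "test_element_mono F a"
proof (rule ccontr)
  interpret group F
    using assms(2) by (simp add: free_group_of_rank_def)
  interpret based_free_group F S
    using assms(4) by unfold_locales (simp add: minimizing_basis_def)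
  obtain B where B: "free_basis F B" "finite B" "card B = r"
    using assms(2) by (auto simp: free_group_of_rank_def)
  have finS: "finite S"
    by (rule finite_basis[OF B(1,2) basis])
  have "\<exists>b \<in> B. \<exists>c \<in> B. b \<noteq> c"
    using B(2,3) assms(1) card_le_Suc0_iff_eq[of B] by fastforce
  then obtain s t where st: "s \<in> S" "t \<in> S" "s \<noteq> t"
    using basis_two_elements[OF B(1) _ _ _ basis] by blast
  have w: "w \<in> carrier F"
    using assms(3) by (simp add: test_element_mono_def)
  have "w \<noteq> \<one>\<^bsub>F\<^esub>"
    using generator_occurs[OF assms(3) st(1)] by auto
  assume "\<not> test_element_mono F a"
  then obtain \<phi> where \<phi>: "\<phi> \<in> mon F F" "\<phi> a = a" "\<phi> \<notin> iso F F"
    using assms(5) by (auto simp: test_element_mono_def)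
  obtain P where P: "P \<subseteq> carrier F" "P \<noteq> {}" "P \<noteq> carrier F" "almost_invariant P"
      "\<And>g. g \<in> carrier F \<Longrightarrow> g \<otimes>\<^bsub>F\<^esub> a \<in> P \<longleftrightarrow> g \<in> P"
    using fixed_element_almost_invariant[OF finS \<phi>(1,3) assms(5) \<phi>(2)] by blast
  obtain p l k where p: "axis_line a p l k"
    using axis_line_exists[OF assms(5,6)] by blast
  then have pl: "labelled_line p l"
    by (simp add: axis_line_def)
  obtain q m where q: "axis_line w q m (int (len w))" "q 0 = \<one>\<^bsub>F\<^esub>"
    using minimizing_axis_line[OF assms(4) w \<open>w \<noteq> \<one>\<^bsub>F\<^esub>\<close>] by blast
  have "enat (len w + 1) \<le> num_edges (range (edge p) \<inter> range (edge q))"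
    using assms(7) axis_eq[OF assms(5,6) p] axis_eq[OF w \<open>w \<noteq> \<one>\<^bsub>F\<^esub>\<close> q(1)] by simp
  note turns = turns_of_axis_overlap[OF w pl q(1) this]
  show False
  proof (rule almost_invariant_contradiction[OF finS st assms(5) p P])
    fix x :: "'a \<times> bool" and C D
    assume x: "x \<in> S \<times> UNIV" "C \<union> D = S \<times> UNIV - {x}" "C \<inter> D = {}" "C \<noteq> {}" "D \<noteq> {}"
    obtain i where "flip (m (i - 1)) \<in> C \<and> m i \<in> D \<or> flip (m (i - 1)) \<in> D \<and> m i \<in> C"
      using axis_whitehead_graph_no_cut_vertex[OF assms(4,3) q x] by blast
    \<comment> \<open>The overlap may traverse the turn in either direction; the claim is symmetric
      under exchanging the two directions.\<close>
    then show "\<exists>i. flip (l (i - 1)) \<in> C \<and> l i \<in> D \<or> flip (l (i - 1)) \<in> D \<and> l i \<in> C"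
      using turns[of i] by metis
  qed
qed

end
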